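(* Let $1\le k\le n$ and let $\xi_0,\dots,\xi_n$ be independent real random variables with densities $f_0,\dots,f_n$. For distinct $x_1,\dots,x_k\in\mathbb R$, $\mathbf x=(x_1,\dots,x_k)$, the $k$-correlation function of the real zeros of $P_n=\sum_{i=0}^n\xi_ip_i$ satisfies $$\rho_k(\mathbf x)=\prod_{m=0}^n\gamma_m^{-1}\prod_{1\le i<j\le k}|x_i-x_j|\int_{\mathbb R^{n-k+1}}\prod_{l=0}^nf_l\Big(\sum_{i=l}^n\Big(\sum_{j=0}^{n-k}(-1)^{k-i+j}\sigma_{k-i+j}(\mathbf x)t_j\Big)\langle x^i,p_l\rangle_\mu\Big)\prod_{i=1}^k\Big|\sum_{j=0}^{n-k}t_jx_i^j\Big|\,dt_0\cdots dt_{n-k}.$$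
   Context: $\{p_i\}$ are orthonormal polynomials w.r.t. a measure $\mu$ on $\mathbb R$ with all moments finite, $p_i(x)=\gamma_ix^i+\dots$, $\gamma_i>0$; $\langle p,q\rangle_\mu=\int pq\,d\mu$. $\sigma_i(\mathbf x)=\sum_{1\le j_1<\dots<j_i\le k}x_{j_1}\cdots x_{j_i}$ are the elementary symmetric polynomials, with $\sigma_0=1$ and $\sigma_i=0$ for $i<0$ or $i>k$. The $k$-correlation function $\rho_k$ is defined by $\mathbb E\sum G(\zeta_{i_1},\dots,\zeta_{i_k})=\int_{\mathbb R^k}G\rho_k$ for all continuous compactly supported $G$, the sum over $k$-tuples of distinct real zeros of $P_n$. *)

theory Defs
  imports "HOL-Probability.Probability" "HOL-Computational_Algebra.Polynomial"
begin

definition esym :: "nat \<Rightarrow> (nat \<Rightarrow> real) \<Rightarrow> int \<Rightarrow> real" where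
  "esym k x m = (if m < 0 then 0
     else (\<Sum>S\<in>{S. S \<subseteq> {1..k} \<and> card S = nat m}. \<Prod>j\<in>S. x j))"

definition zero_tuples :: "nat \<Rightarrow> (real \<Rightarrow> real) \<Rightarrow> (nat \<Rightarrow> real) set" where
  "zero_tuples k P = {x \<in> PiE {1..k} (\<lambda>_. UNIV).
      inj_on x {1..k} \<and> (\<forall>i\<in>{1..k}. P (x i) = 0)}"

end

theory Submission
  imports Defs
begin

text \<open>
  The zeros are peeled off one at a time, which avoids any multidimensional change of variables.
  If $a_1, \ldots, a_m$ are fixed, then $x$ is a zero of $\sum a_i y^i$ exactly when $a_0 = h(x)$ for a
  polynomial $h$, so the one-dimensional area formula trades integration over $a_0$ for integration
  over $x$ with weight $|h'(x)|$. For fixed $x$, passing from $a_1, \ldots, a_m$ to the coefficients of the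
  quotient $b$ of the polynomial by $y - x$ is a unipotent linear map, and $|h'(x)| = |b(x)|$. Iterating over the zeros
  of successive quotients produces the Vandermonde factor and the factors $|\sum t_j x_i^j|$.
  Finally, passing from monomial coefficients to the $\xi_l$ is a triangular linear map with diagonal entries
  $\langle x^l, p_l \rangle = \gamma_l^{-1}$. The formula is proved for nonnegative functions and applied to the
  positive and negative part of $G$; both are finite as there are at most $n^k$ tuples.
\<close>

section \<open>Triangular linear maps on coefficient space\<close>

text \<open>A sum over the roots of a random polynomial runs over a finite set that varies with the
  coefficients, and it must be measurable before any exchange of integrals makes sense. No
  measurable enumeration of the roots is chosen: root counts on half-open intervals are shown to be
  measurable, they define a kernel, and sums over roots become integrals against it.

  The constant coefficient is the one that is traded for a root because it enters additively. A root
  \<open>x\<close> determines it from the other coefficients, so these can stay fixed while one real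
  variable is substituted.

  Working with values in [0, \<infinity>] leaves a gap to the stated formula. The integral over
  \<open>t\<close> may be infinite at some \<open>x\<close>, where a Bochner integral takes the
  default value 0. For bounded \<open>G\<close> the expected sum is finite, which forces such
  points, up to a null set, into the region where \<open>G\<close> or the prefactor
  vanishes.\<close>

abbreviation lborel_vec :: "nat \<Rightarrow> (nat \<Rightarrow> real) measure" where
  "lborel_vec m \<equiv> PiM {..m} (\<lambda>_. lborel)"

interpretation lborel_product: product_sigma_finite "\<lambda>_::nat. lborel :: real measure"
  by standard

lemma measurable_case_nat_vec [measurable]:
  "(\<lambda>(a, c). case_nat c a) \<in> lborel_vec m \<Otimes>\<^sub>M lborel \<rightarrow>\<^sub>M lborel_vec (Suc m)"
proof (rule measurable_PiM_single')
  fix i assume "i \<in> {..Suc m}"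
  then show "(\<lambda>w. (case w of (a, c) \<Rightarrow> case_nat c a) i) \<in> lborel_vec m \<Otimes>\<^sub>M lborel \<rightarrow>\<^sub>M lborel"
    by (cases i) (auto simp: case_prod_beta)
next
  show "(\<lambda>w. case w of (a, c) \<Rightarrow> case_nat c a) \<in> space (lborel_vec m \<Otimes>\<^sub>M lborel) \<rightarrow> {..Suc m} \<rightarrow>\<^sub>E space lborel"
    by (auto simp: space_pair_measure space_PiM PiE_def extensional_def split: nat.splits)
qed

text \<open>The new coordinate enters at index 0, so that \<open>c\<close> plays the constant
  coefficient, the variable of the area formula. A product measure is determined by its values on
  boxes, and preimages of boxes are again boxes.\<close>

lemma distr_case_nat_lborel_vec:
  "distr (lborel_vec m \<Otimes>\<^sub>M lborel) (lborel_vec (Suc m)) (\<lambda>(a, c). case_nat c a) = lborel_vec (Suc m)"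
proof (rule lborel_product.PiM_eqI)
  interpret V: finite_product_sigma_finite "\<lambda>_::nat. lborel :: real measure" "{..m}" by standard simp
  fix A :: "nat \<Rightarrow> real set" assume A: "\<And>i. i \<in> {..Suc m} \<Longrightarrow> A i \<in> sets lborel"
  have "(\<lambda>(a, c). case_nat c a) -` Pi\<^sub>E {..Suc m} A \<inter> space (lborel_vec m \<Otimes>\<^sub>M lborel)
      = Pi\<^sub>E {..m} (\<lambda>i. A (Suc i)) \<times> A 0"
    by (force simp: space_pair_measure space_PiM PiE_def extensional_def Pi_def split: nat.splits)
  moreover have "emeasure (lborel_vec m) (Pi\<^sub>E {..m} (\<lambda>i. A (Suc i))) = (\<Prod>i\<le>m. emeasure lborel (A (Suc i)))"
    using A by (intro V.measure_times) auto
  moreover have "Pi\<^sub>E {..m} (\<lambda>i. A (Suc i)) \<in> sets (lborel_vec m)"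
    using A by (intro sets_PiM_I_finite) auto
  moreover have "Pi\<^sub>E {..Suc m} A \<in> sets (lborel_vec (Suc m))"
    using A by (intro sets_PiM_I_finite) auto
  ultimately show "emeasure (distr (lborel_vec m \<Otimes>\<^sub>M lborel) (lborel_vec (Suc m)) (\<lambda>(a, c). case_nat c a))
      (Pi\<^sub>E {..Suc m} A) = (\<Prod>i\<in>{..Suc m}. emeasure lborel (A i))"
    using A by (simp add: emeasure_distr lborel.emeasure_pair_measure_Times prod.atMost_Suc_shift mult.commute
      del: prod.atMost_Suc)
qed simp_all

lemma nn_integral_lborel_vec_Suc:
  assumes [measurable]: "F \<in> borel_measurable (lborel_vec (Suc m))"
  shows "(\<integral>\<^sup>+a. F a \<partial>lborel_vec (Suc m)) = (\<integral>\<^sup>+a. \<integral>\<^sup>+c. F (case_nat c a) \<partial>lborel \<partial>lborel_vec m)"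
proof -
  have "(\<integral>\<^sup>+a. F a \<partial>lborel_vec (Suc m)) =
      (\<integral>\<^sup>+a. F a \<partial>distr (lborel_vec m \<Otimes>\<^sub>M lborel) (lborel_vec (Suc m)) (\<lambda>(a, c). case_nat c a))"
    by (simp add: distr_case_nat_lborel_vec)
  also have "\<dots> = (\<integral>\<^sup>+w. F (case w of (a, c) \<Rightarrow> case_nat c a) \<partial>(lborel_vec m \<Otimes>\<^sub>M lborel))"
    by (rule nn_integral_distr) simp_all
  also have "\<dots> = (\<integral>\<^sup>+a. \<integral>\<^sup>+c. F (case_nat c a) \<partial>lborel \<partial>lborel_vec m)"
    by (subst lborel.nn_integral_fst[symmetric]) (simp_all add: case_prod_beta)
  finally show ?thesis .
qed

text \<open>Only entries of \<open>C\<close> on and above the diagonal enter. The restriction keeps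
  the image among the extensional functions, the space of the product measure.\<close>

definition triangular_map :: "(nat \<Rightarrow> nat \<Rightarrow> real) \<Rightarrow> nat \<Rightarrow> (nat \<Rightarrow> real) \<Rightarrow> nat \<Rightarrow> real" where
  "triangular_map C m a = (\<lambda>l\<in>{..m}. \<Sum>i=l..m. C l i * a i)"

lemma measurable_triangular_map [measurable]:
  "triangular_map C m \<in> lborel_vec m \<rightarrow>\<^sub>M lborel_vec m"
  unfolding triangular_map_def[abs_def]
  by (rule measurable_restrict) (auto intro!: borel_measurable_sum borel_measurable_times)

lemma triangular_map_case_nat:
  "triangular_map C (Suc m) (case_nat c a) =
    case_nat (C 0 0 * c + (\<Sum>i\<le>m. C 0 (Suc i) * a i)) (triangular_map (\<lambda>l i. C (Suc l) (Suc i)) m a)"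
proof
  fix l
  have *: "(\<Sum>i=0..Suc m. C 0 i * (case i of 0 \<Rightarrow> c | Suc i \<Rightarrow> a i)) = C 0 0 * c + (\<Sum>i\<le>m. C 0 (Suc i) * a i)"
    unfolding atLeast0AtMost by (subst sum.atMost_Suc_shift) simp
  have **: "(\<Sum>i=Suc l..Suc m. C (Suc l) i * (case i of 0 \<Rightarrow> c | Suc i \<Rightarrow> a i))
    = (\<Sum>i=l..m. C (Suc l) (Suc i) * a i)" for l
    by (subst sum.shift_bounds_cl_Suc_ivl) simp
  show "triangular_map C (Suc m) (case_nat c a) l =
    case_nat (C 0 0 * c + (\<Sum>i\<le>m. C 0 (Suc i) * a i)) (triangular_map (\<lambda>l i. C (Suc l) (Suc i)) m a) l"
    by (cases l) (simp_all add: triangular_map_def * ** del: sum.cl_ivl_Suc)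
qed

text \<open>By \<open>triangular_map_case_nat\<close>, for fixed \<open>a\<close> the coordinate
  \<open>c\<close> undergoes an affine map with slope \<open>C 0 0\<close> and an offset depending
  on \<open>a\<close> alone. Each dimension thus costs one real affine substitution, and the minor
  without row and column 0 is left to the induction.\<close>

lemma nn_integral_triangular_map:
  assumes "\<And>l. l \<le> m \<Longrightarrow> C l l \<noteq> 0" and "F \<in> borel_measurable (lborel_vec m)"
  shows "(\<integral>\<^sup>+a. F a \<partial>lborel_vec m) =
    ennreal (\<Prod>l\<le>m. \<bar>C l l\<bar>) * (\<integral>\<^sup>+a. F (triangular_map C m a) \<partial>lborel_vec m)"
  using assms
proof (induction m arbitrary: C F)
  case 0
  note [measurable] = 0(2)
  have [measurable]: "(\<lambda>c. \<lambda>_\<in>{0::nat}. c) \<in> lborel \<rightarrow>\<^sub>M PiM {0} (\<lambda>_. lborel :: real measure)"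
    by (rule measurable_restrict) simp
  have [simp]: "{..0} = {0::nat}" by auto
  have F[measurable]: "F \<in> borel_measurable (PiM {0} (\<lambda>_. lborel))" using 0(2) by simp
  \<comment> \<open>A product over the single index 0 is \<open>lborel\<close> in disguise, so the
    base case is a scaling of the line.\<close>
  have G: "(\<integral>\<^sup>+a. G a \<partial>PiM {0::nat} (\<lambda>_. lborel)) = (\<integral>\<^sup>+c. G (\<lambda>_\<in>{0::nat}. c) \<partial>lborel)"
    if G[measurable]: "G \<in> borel_measurable (PiM {0} (\<lambda>_. lborel))" for G :: "(nat \<Rightarrow> real) \<Rightarrow> ennreal"
  proof -
    have "(\<integral>\<^sup>+a. G a \<partial>PiM {0::nat} (\<lambda>_. lborel)) = (\<integral>\<^sup>+a. G (\<lambda>_\<in>{0}. a 0) \<partial>PiM {0::nat} (\<lambda>_. lborel))"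
      by (intro nn_integral_cong arg_cong[of _ _ G])
        (auto simp: space_PiM PiE_def extensional_def restrict_def)
    also have "\<dots> = (\<integral>\<^sup>+c. G (\<lambda>_\<in>{0::nat}. c) \<partial>lborel)"
      by (rule lborel_product.product_nn_integral_singleton) simp
    finally show ?thesis .
  qed
  have T[measurable]: "triangular_map C 0 \<in> PiM {0} (\<lambda>_. lborel) \<rightarrow>\<^sub>M PiM {0} (\<lambda>_. lborel)"
    using measurable_triangular_map[of C 0] by simp
  have T0: "triangular_map C 0 (\<lambda>_\<in>{0}. c) = (\<lambda>_\<in>{0}. 0 + C 0 0 * c)" for c
    by (auto simp: triangular_map_def restrict_def)
  have F': "(\<lambda>c. F (\<lambda>_\<in>{0::nat}. c)) \<in> borel_measurable borel"
    using measurable_compose[OF \<open>(\<lambda>c. \<lambda>_\<in>{0::nat}. c) \<in> lborel \<rightarrow>\<^sub>M _\<close> F] by simp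
  show ?case
    using 0(1)[of 0] nn_integral_real_affine[OF F', of "C 0 0" 0]
    by (simp add: G T0)
next
  case (Suc m)
  note [measurable] = Suc.prems(2)
  define C' where "C' = (\<lambda>l i. C (Suc l) (Suc i))"
  define g where "g a = (\<Sum>i\<le>m. C 0 (Suc i) * a i)" for a :: "nat \<Rightarrow> real"
  have [measurable]: "g \<in> borel_measurable (lborel_vec m)" unfolding g_def[abs_def] by measurable
  let ?P = "ennreal (\<Prod>l\<le>m. \<bar>C' l l\<bar>)"
  have ne: "C' l l \<noteq> 0" if "l \<le> m" for l using Suc.prems(1)[of "Suc l"] that by (simp add: C'_def)
  have ne0: "C 0 0 \<noteq> 0" using Suc.prems(1)[of 0] by simp
  have Fc[measurable]: "(\<lambda>c. F (case_nat c a)) \<in> borel_measurable borel" if "a \<in> space (lborel_vec m)" for a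
  proof -
    have "(\<lambda>c. (a, c)) \<in> borel \<rightarrow>\<^sub>M lborel_vec m \<Otimes>\<^sub>M lborel" using that by measurable
    from measurable_compose[OF measurable_compose[OF this measurable_case_nat_vec] Suc.prems(2)] show ?thesis by simp
  qed
  have F2[measurable]: "(\<lambda>(a, c). F (case_nat c a)) \<in> borel_measurable (lborel_vec m \<Otimes>\<^sub>M lborel)"
    using measurable_compose[OF measurable_case_nat_vec Suc.prems(2)] by (simp add: case_prod_beta)
  have "(\<integral>\<^sup>+a. F a \<partial>lborel_vec (Suc m)) = (\<integral>\<^sup>+a. \<integral>\<^sup>+c. F (case_nat c a) \<partial>lborel \<partial>lborel_vec m)"
    by (rule nn_integral_lborel_vec_Suc) simp
  \<comment> \<open>The induction hypothesis transforms the outer variable, with the whole inner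
    integral over \<open>c\<close> as its integrand; slope and offset in \<open>c\<close> are
    introduced afterwards.\<close>
  also have "\<dots> = ?P * (\<integral>\<^sup>+a. \<integral>\<^sup>+c. F (case_nat c (triangular_map C' m a)) \<partial>lborel \<partial>lborel_vec m)"
    by (rule Suc.IH[OF ne]) (auto intro!: lborel.borel_measurable_nn_integral)
  also have "\<dots> = ?P * (\<integral>\<^sup>+a. ennreal \<bar>C 0 0\<bar> * (\<integral>\<^sup>+c. F (case_nat (g a + C 0 0 * c) (triangular_map C' m a)) \<partial>lborel) \<partial>lborel_vec m)"
    by (intro arg_cong[of _ _ "\<lambda>x. ?P * x"] nn_integral_cong nn_integral_real_affine Fc ne0)
      (auto intro: measurable_space[OF measurable_triangular_map])
  also have "\<dots> = ?P * (\<integral>\<^sup>+a. ennreal \<bar>C 0 0\<bar> * (\<integral>\<^sup>+c. F (triangular_map C (Suc m) (case_nat c a)) \<partial>lborel) \<partial>lborel_vec m)"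
    by (simp add: triangular_map_case_nat C'_def g_def add.commute)
  also have "\<dots> = ?P * (ennreal \<bar>C 0 0\<bar> * (\<integral>\<^sup>+a. \<integral>\<^sup>+c. F (triangular_map C (Suc m) (case_nat c a)) \<partial>lborel \<partial>lborel_vec m))"
  proof -
    have "(\<lambda>w. F (triangular_map C (Suc m) (case w of (a, c) \<Rightarrow> case_nat c a))) \<in> borel_measurable (lborel_vec m \<Otimes>\<^sub>M lborel)"
      by measurable
    then have [measurable]: "(\<lambda>(a, c). F (triangular_map C (Suc m) (case_nat c a))) \<in> borel_measurable (lborel_vec m \<Otimes>\<^sub>M lborel)"
      by (simp add: case_prod_beta)
    show ?thesis by (subst nn_integral_cmult) (auto intro!: lborel.borel_measurable_nn_integral)
  qed
  also have "\<dots> = ?P * (ennreal \<bar>C 0 0\<bar> * (\<integral>\<^sup>+a. F (triangular_map C (Suc m) a) \<partial>lborel_vec (Suc m)))"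
    by (subst nn_integral_lborel_vec_Suc[where m=m]) simp_all
  also have "\<dots> = ennreal (\<Prod>l\<le>Suc m. \<bar>C l l\<bar>) * (\<integral>\<^sup>+a. F (triangular_map C (Suc m) a) \<partial>lborel_vec (Suc m))"
    by (simp only: prod.atMost_Suc_shift C'_def mult.assoc[symmetric]) 
      (simp add: ennreal_mult[symmetric] prod_nonneg mult.commute)
  finally show ?case .
qed

section \<open>Measurability of sums over real roots\<close>

text \<open>
  The zero polynomial gets no roots, so that all sums below are finite; this agrees with the value 0
  that a sum over the infinite set of its zeros takes.
\<close>
definition real_roots :: "real poly \<Rightarrow> real set" where
  "real_roots q = (if q = 0 then {} else {x. poly q x = 0})"

definition vec_poly :: "nat \<Rightarrow> (nat \<Rightarrow> real) \<Rightarrow> real poly" where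
  "vec_poly m a = (\<Sum>i\<le>m. monom (a i) i)"

lemma finite_real_roots [simp, intro]: "finite (real_roots q)"
  by (simp add: real_roots_def poly_roots_finite)

lemma card_real_roots_le: "card (real_roots q) \<le> degree q"
  by (simp add: real_roots_def card_poly_roots_bound)

lemma coeff_vec_poly: "coeff (vec_poly m a) i = (if i \<le> m then a i else 0)"
  by (simp add: vec_poly_def coeff_sum)

lemma poly_vec_poly: "poly (vec_poly m a) x = (\<Sum>i\<le>m. a i * x ^ i)"
  by (simp add: vec_poly_def poly_sum poly_monom)

lemma degree_vec_poly_le: "degree (vec_poly m a) \<le> m"
  by (rule degree_le) (simp add: coeff_vec_poly)

lemma vec_poly_eq_0_iff: "vec_poly m a = 0 \<longleftrightarrow> (\<forall>i\<le>m. a i = 0)"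
  by (auto simp: poly_eq_iff coeff_vec_poly)

lemma vec_poly_case_nat: "vec_poly (Suc m) (case_nat c a) = pCons c (vec_poly m a)"
  by (rule poly_eqI) (simp add: coeff_vec_poly coeff_pCons split: nat.splits)

lemma measurable_lborel_vec_component:
  assumes "L \<in> N \<rightarrow>\<^sub>M lborel_vec m" and "i \<le> m"
  shows "(\<lambda>w. L w i) \<in> borel_measurable N"
proof -
  have "(\<lambda>a. a i) \<in> lborel_vec m \<rightarrow>\<^sub>M lborel"
    using assms(2) by (intro measurable_component_singleton) simp
  from measurable_compose[OF assms(1) this] show ?thesis by simp
qed

lemma borel_measurable_poly_vec_poly [measurable]:
  assumes [measurable]: "L \<in> N \<rightarrow>\<^sub>M lborel_vec m" "y \<in> borel_measurable N"
  shows "(\<lambda>w. poly (vec_poly m (L w)) (y w)) \<in> borel_measurable N"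
  unfolding poly_vec_poly
  by (intro borel_measurable_sum borel_measurable_times borel_measurable_power
    measurable_lborel_vec_component[OF assms(1)] assms(2)) simp

lemma borel_measurable_poly [measurable (raw)]:
  fixes q :: "real poly"
  assumes "f \<in> borel_measurable N"
  shows "(\<lambda>w. poly q (f w)) \<in> borel_measurable N"
proof -
  have "poly q \<in> borel_measurable borel" by (intro borel_measurable_continuous_onI continuous_intros)
  from measurable_compose[OF assms this] show ?thesis .
qed

section \<open>Measurability of root counts on intervals\<close>

lemma pred_vec_poly_eq_0 [measurable]: "Measurable.pred (lborel_vec m) (\<lambda>a. vec_poly m a = 0)"
proof -
  have [measurable]: "Measurable.pred (lborel_vec m) (\<lambda>a. i \<le> m \<longrightarrow> a i = 0)" for i
  proof (cases "i \<le> m")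
    case True
    then have [measurable]: "(\<lambda>a. a i) \<in> borel_measurable (lborel_vec m)"
      by (intro measurable_lborel_vec_component) auto
    show ?thesis by measurable
  qed simp
  show ?thesis unfolding vec_poly_eq_0_iff by measurable
qed

text \<open>By compactness the modulus of \<open>q\<close> attains its minimum on the interval, so a
  root exists iff values at rational points get arbitrarily small. The right-hand side uses
  countable quantifiers only, which is what measurability in the coefficients needs. Strictness of
  \<open>u < v\<close> makes the rationals dense in the interval.\<close>

lemma ex_poly_root_Icc_iff:
  fixes q :: "real poly"
  assumes "u < v"
  shows "(\<exists>z\<in>{u..v}. poly q z = 0) \<longleftrightarrow>
    (\<forall>i::nat. \<exists>r::rat. u \<le> of_rat r \<and> of_rat r \<le> v \<and> \<bar>poly q (of_rat r)\<bar> < inverse (of_nat (Suc i)))"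
proof (intro iffI allI)
  fix i :: nat
  assume "\<exists>z\<in>{u..v}. poly q z = 0"
  then obtain z where z: "u \<le> z" "z \<le> v" "poly q z = 0" by auto
  have "isCont (poly q) z" by simp
  moreover have "0 < inverse (of_nat (Suc i) :: real)" by simp
  ultimately obtain d where d: "d > 0" "\<And>y. dist y z < d \<Longrightarrow> dist (poly q y) (poly q z) < inverse (of_nat (Suc i))"
    unfolding continuous_at_eps_delta by meson
  have "max u (z - d) < min v (z + d)" using z d(1) assms by auto
  then obtain r :: rat where "max u (z - d) < of_rat r" "of_rat r < min v (z + d)"
    using of_rat_dense by blast
  then show "\<exists>r::rat. u \<le> of_rat r \<and> of_rat r \<le> v \<and> \<bar>poly q (of_rat r)\<bar> < inverse (of_nat (Suc i))"
    using d(2)[of "of_rat r"] z(3) by (intro exI[of _ r]) (auto simp: dist_real_def)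
next
  assume *: "\<forall>i::nat. \<exists>r::rat. u \<le> of_rat r \<and> of_rat r \<le> v \<and> \<bar>poly q (of_rat r)\<bar> < inverse (of_nat (Suc i))"
  have "\<exists>z\<in>{u..v}. \<forall>y\<in>{u..v}. \<bar>poly q z\<bar> \<le> \<bar>poly q y\<bar>"
    using assms by (intro continuous_attains_inf) (auto intro!: continuous_intros)
  then obtain z where z: "z \<in> {u..v}" "\<And>y. y \<in> {u..v} \<Longrightarrow> \<bar>poly q z\<bar> \<le> \<bar>poly q y\<bar>" by auto
  have "poly q z = 0"
  proof (rule ccontr)
    assume "poly q z \<noteq> 0"
    then obtain i :: nat where "inverse (of_nat (Suc i)) < \<bar>poly q z\<bar>"
      using reals_Archimedean[of "\<bar>poly q z\<bar>"] by auto
    moreover obtain r :: rat where "u \<le> of_rat r" "of_rat r \<le> v" "\<bar>poly q (of_rat r)\<bar> < inverse (of_nat (Suc i))"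
      using * by blast
    ultimately show False using z(2)[of "of_rat r"] by simp
  qed
  with z(1) show "\<exists>z\<in>{u..v}. poly q z = 0" by auto
qed

lemma pred_ex_root_Icc [measurable]:
  assumes "u < v"
  shows "Measurable.pred (lborel_vec m) (\<lambda>a. \<exists>z\<in>{u..v}. poly (vec_poly m a) z = 0)"
  unfolding ex_poly_root_Icc_iff[OF assms] by measurable

text \<open>The closed intervals \<open>{e i..d}\<close> exhaust \<open>{c<..d}\<close>, which
  reduces the claim to the criterion for closed intervals.\<close>

lemma pred_card_real_roots_pos:
  "Measurable.pred (lborel_vec m) (\<lambda>a. 1 \<le> card (real_roots (vec_poly m a) \<inter> {c<..d}))"
proof (cases "c < d")
  case True
  \<comment> \<open>The offset 2 keeps \<open>e i\<close> strictly between \<open>c\<close> and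
    \<open>d\<close>, so that \<open>{e i..d}\<close> is never degenerate.\<close>
  define e where "e i = c + (d - c) / real (i + 2)" for i :: nat
  have e: "c < e i" "e i < d" for i
  proof -
    have "(d - c) * 1 < (d - c) * real (i + 2)" using True by (intro mult_strict_left_mono) auto
    then show "c < e i" "e i < d" using True by (auto simp: e_def field_simps)
  qed
  have "e \<longlonglongrightarrow> c + 0"
    unfolding e_def by (intro tendsto_intros LIMSEQ_ignore_initial_segment lim_const_over_n)
  have ex: "\<exists>i. e i \<le> z" if "c < z" for z
    using order_tendstoD(2)[OF \<open>e \<longlonglongrightarrow> c + 0\<close>, of z] that
    by (auto simp: eventually_sequentially intro: less_imp_le)
  have "1 \<le> card (real_roots q \<inter> {c<..d}) \<longleftrightarrow> q \<noteq> 0 \<and> (\<exists>i. \<exists>z\<in>{e i..d}. poly q z = 0)" for q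
  proof -
    have "1 \<le> card (real_roots q \<inter> {c<..d}) \<longleftrightarrow> real_roots q \<inter> {c<..d} \<noteq> {}"
      by (simp add: Suc_le_eq card_gt_0_iff)
    also have "\<dots> \<longleftrightarrow> q \<noteq> 0 \<and> (\<exists>i. \<exists>z\<in>{e i..d}. poly q z = 0)"
    proof
      assume "real_roots q \<inter> {c<..d} \<noteq> {}"
      then obtain z where z: "z \<in> real_roots q" "c < z" "z \<le> d" by auto
      moreover obtain i where "e i \<le> z" using ex[OF z(2)] ..
      ultimately have "q \<noteq> 0" "z \<in> {e i..d}" "poly q z = 0"
        by (auto simp: real_roots_def split: if_splits)
      then show "q \<noteq> 0 \<and> (\<exists>i. \<exists>z\<in>{e i..d}. poly q z = 0)" by blast
    next
      assume "q \<noteq> 0 \<and> (\<exists>i. \<exists>z\<in>{e i..d}. poly q z = 0)"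
      then obtain i z where z: "q \<noteq> 0" "e i \<le> z" "z \<le> d" "poly q z = 0" by auto
      with e(1)[of i] have "z \<in> real_roots q \<inter> {c<..d}" by (auto simp: real_roots_def)
      then show "real_roots q \<inter> {c<..d} \<noteq> {}" by blast
    qed
    finally show ?thesis .
  qed
  moreover note [measurable] = pred_ex_root_Icc[OF e(2)]
  ultimately show ?thesis by simp
qed simp

text \<open>A rational between the two largest points splits off the largest one. This is the
  induction step for measurability of root counts, again with a countable quantifier only.\<close>

lemma Suc_Suc_le_card_Ioc_iff:
  fixes Z :: "real set"
  assumes Z: "finite Z"
  shows "Suc (Suc j) \<le> card (Z \<inter> {c<..d}) \<longleftrightarrow>
    (\<exists>r::rat. c < of_rat r \<and> of_rat r < d \<and> Suc j \<le> card (Z \<inter> {c<..of_rat r}) \<and> 1 \<le> card (Z \<inter> {of_rat r<..d}))"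
proof
  assume *: "Suc (Suc j) \<le> card (Z \<inter> {c<..d})"
  let ?A = "Z \<inter> {c<..d}"
  have fin: "finite ?A" using Z by simp
  have ne: "?A \<noteq> {}" using * by (metis card.empty not_less_eq_eq le0)
  define z where "z = Max ?A"
  have z: "z \<in> ?A" unfolding z_def using fin ne by (rule Max_in)
  let ?B = "?A - {z}"
  have cB: "Suc j \<le> card ?B" using * z fin by simp
  then have neB: "?B \<noteq> {}" by (metis card.empty not_less_eq_eq le0)
  define w where "w = Max ?B"
  have w: "w \<in> ?B" unfolding w_def using fin neB by (intro Max_in) auto
  have "w < z" using w Max_ge[OF fin, of w] by (auto simp: z_def less_le)
  then obtain r :: rat where r: "w < of_rat r" "of_rat r < z" using of_rat_dense by blast
  have "?B \<subseteq> Z \<inter> {c<..of_rat r}"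
  proof
    fix y assume y: "y \<in> ?B"
    then have "y \<le> w" unfolding w_def using fin by (intro Max_ge) auto
    then show "y \<in> Z \<inter> {c<..of_rat r}" using y r by auto
  qed
  then have "card ?B \<le> card (Z \<inter> {c<..of_rat r})" using Z by (intro card_mono) auto
  moreover have "z \<in> Z \<inter> {of_rat r<..d}" using z r by auto
  then have "Z \<inter> {of_rat r<..d} \<noteq> {}" by blast
  then have "1 \<le> card (Z \<inter> {of_rat r<..d})" using Z by (simp add: Suc_le_eq card_gt_0_iff)
  ultimately show "\<exists>r::rat. c < of_rat r \<and> of_rat r < d \<and> Suc j \<le> card (Z \<inter> {c<..of_rat r}) \<and> 1 \<le> card (Z \<inter> {of_rat r<..d})"
    using r z w cB by (intro exI[of _ r]) auto
next
  assume "\<exists>r::rat. c < of_rat r \<and> of_rat r < d \<and> Suc j \<le> card (Z \<inter> {c<..of_rat r}) \<and> 1 \<le> card (Z \<inter> {of_rat r<..d})"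
  then obtain r :: rat where r: "c < of_rat r" "of_rat r < d" "Suc j \<le> card (Z \<inter> {c<..of_rat r})"
    "1 \<le> card (Z \<inter> {of_rat r<..d})" by blast
  have "card ((Z \<inter> {c<..of_rat r}) \<union> (Z \<inter> {of_rat r<..d})) = card (Z \<inter> {c<..of_rat r}) + card (Z \<inter> {of_rat r<..d})"
    using Z by (intro card_Un_disjoint) auto
  moreover have "(Z \<inter> {c<..of_rat r}) \<union> (Z \<inter> {of_rat r<..d}) = Z \<inter> {c<..d}"
    using r(1,2) by auto
  ultimately show "Suc (Suc j) \<le> card (Z \<inter> {c<..d})" using r(3,4) by simp
qed

lemma pred_le_card_real_roots:
  "Measurable.pred (lborel_vec m) (\<lambda>a. j \<le> card (real_roots (vec_poly m a) \<inter> {c<..d}))"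
proof (cases j)
  case (Suc j')
  have "Measurable.pred (lborel_vec m) (\<lambda>a. Suc j' \<le> card (real_roots (vec_poly m a) \<inter> {c<..d}))"
  proof (induction j' arbitrary: d)
    case 0
    then show ?case using pred_card_real_roots_pos by simp
  next
    case (Suc j')
    note [measurable] = Suc.IH pred_card_real_roots_pos
    show ?case unfolding Suc_Suc_le_card_Ioc_iff[OF finite_real_roots] by measurable
  qed
  then show ?thesis using Suc by simp
qed simp

lemma measurable_card_real_roots [measurable]:
  "(\<lambda>a. card (real_roots (vec_poly m a) \<inter> {c<..d})) \<in> lborel_vec m \<rightarrow>\<^sub>M count_space UNIV"
proof (subst measurable_count_space_eq2_countable, safe)
  fix j
  note [measurable] = pred_le_card_real_roots
  have "Measurable.pred (lborel_vec m) (\<lambda>a. j \<le> card (real_roots (vec_poly m a) \<inter> {c<..d}) \<and>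
      \<not> Suc j \<le> card (real_roots (vec_poly m a) \<inter> {c<..d}))" by measurable
  moreover have "j \<le> i \<and> \<not> Suc j \<le> i \<longleftrightarrow> i = j" for i by auto
  ultimately have "Measurable.pred (lborel_vec m) (\<lambda>a. card (real_roots (vec_poly m a) \<inter> {c<..d}) = j)" by simp
  then show "(\<lambda>a. card (real_roots (vec_poly m a) \<inter> {c<..d})) -` {j} \<inter> space (lborel_vec m) \<in> sets (lborel_vec m)"
    by (simp add: pred_def vimage_def Int_def conj_commute)
qed simp_all

text \<open>Normalised to total mass at most 1, so that the Giry monad's machinery for sub-probability kernels applies.\<close>
definition root_kernel :: "nat \<Rightarrow> real poly \<Rightarrow> real measure" where
  "root_kernel m q = distr (point_measure (real_roots q) (\<lambda>_. ennreal (1 / real (Suc m)))) borel (\<lambda>x. x)"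

lemma sets_root_kernel [simp]: "sets (root_kernel m q) = sets borel"
  and space_root_kernel [simp]: "space (root_kernel m q) = UNIV"
  by (simp_all add: root_kernel_def)

lemma nn_integral_root_kernel:
  assumes [measurable]: "g \<in> borel_measurable borel"
  shows "(\<integral>\<^sup>+x. g x \<partial>root_kernel m q) = ennreal (1 / real (Suc m)) * (\<Sum>x\<in>real_roots q. g x)"
  unfolding root_kernel_def
  by (subst nn_integral_distr) (auto simp: nn_integral_point_measure_finite sum_distrib_left)

lemma emeasure_root_kernel:
  assumes "B \<in> sets borel"
  shows "emeasure (root_kernel m q) B = ennreal (1 / real (Suc m)) * of_nat (card (real_roots q \<inter> B))"
proof -
  have "emeasure (root_kernel m q) B = (\<integral>\<^sup>+x. indicator B x \<partial>root_kernel m q)"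
    using assms by simp
  also have "\<dots> = ennreal (1 / real (Suc m)) * (\<Sum>x\<in>real_roots q. indicator B x)"
    using assms by (intro nn_integral_root_kernel) simp
  also have "(\<Sum>x\<in>real_roots q. indicator B x :: ennreal) = (\<Sum>x\<in>real_roots q \<inter> B. 1)"
    by (intro sum.mono_neutral_cong_right) (auto simp: indicator_def)
  finally show ?thesis by simp
qed

lemma sets_borel_eq_sigma_sets_Ioc: "sets borel = sigma_sets UNIV (range (\<lambda>(a, b). {a<..b::real}))"
  by (subst borel_sigma_sets_Ioc) (simp add: sets_measure_of)

lemma Int_stable_Ioc: "Int_stable (range (\<lambda>(a, b). {a<..b::real}))"
proof (rule Int_stableI)
  fix A B assume "A \<in> range (\<lambda>(a, b). {a<..b::real})" "B \<in> range (\<lambda>(a, b). {a<..b::real})"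
  then obtain a b c d where "A = {a<..b}" "B = {c<..d}" by auto
  then have "A \<inter> B = (\<lambda>(a, b). {a<..b}) (max a c, min b d)" by auto
  then show "A \<inter> B \<in> range (\<lambda>(a, b). {a<..b::real})" by blast
qed

text \<open>Transfers measurability on coefficient space to the single variable \<open>c\<close>
  while \<open>q\<close> stays fixed.\<close>

lemma pCons_eq_vec_poly_measurable:
  obtains L where "L \<in> borel \<rightarrow>\<^sub>M lborel_vec (Suc (degree q))"
    and "\<And>c. vec_poly (Suc (degree q)) (L c) = pCons c q"
proof
  let ?m = "degree q"
  show "vec_poly (Suc ?m) (case_nat c (\<lambda>i\<in>{..?m}. coeff q i)) = pCons c q" for c
    by (rule poly_eqI) (auto simp: coeff_vec_poly coeff_pCons coeff_eq_0 split: nat.splits)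
  have "(\<lambda>c. ((\<lambda>i\<in>{..?m}. coeff q i), c)) \<in> borel \<rightarrow>\<^sub>M lborel_vec ?m \<Otimes>\<^sub>M lborel"
    by (intro measurable_Pair measurable_const) (auto simp: space_PiM)
  from measurable_compose[OF this measurable_case_nat_vec]
  show "(\<lambda>c. case_nat c (\<lambda>i\<in>{..?m}. coeff q i)) \<in> borel \<rightarrow>\<^sub>M lborel_vec (Suc ?m)" by simp
qed

text \<open>Half-open intervals form an intersection-stable generator of the Borel sets, and on them
  the kernel is a multiple of the root count. The total mass is handled as a limit over growing
  intervals.\<close>

lemma measurable_root_kernel [measurable]:
  "(\<lambda>a. root_kernel m (vec_poly m a)) \<in> lborel_vec m \<rightarrow>\<^sub>M subprob_algebra borel"
proof (rule measurable_subprob_algebra_generated[OF sets_borel_eq_sigma_sets_Ioc Int_stable_Ioc])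
  fix a
  let ?Z = "real_roots (vec_poly m a)"
  have "card ?Z \<le> Suc m"
    using card_real_roots_le[of "vec_poly m a"] degree_vec_poly_le[of m a] by simp
  then have "real (card ?Z) / real (Suc m) \<le> 1" by (simp add: divide_le_eq_1)
  then have "emeasure (root_kernel m (vec_poly m a)) UNIV \<le> 1"
    by (simp add: emeasure_root_kernel ennreal_of_nat_eq_real_of_nat ennreal_mult[symmetric] ennreal_le_1)
  then show "subprob_space (root_kernel m (vec_poly m a))" by (intro subprob_spaceI) auto
next
  have Ioc: "(\<lambda>a. emeasure (root_kernel m (vec_poly m a)) {c<..d}) \<in> borel_measurable (lborel_vec m)" for c d
    by (simp add: emeasure_root_kernel)
  then show "(\<lambda>a. emeasure (root_kernel m (vec_poly m a)) A) \<in> borel_measurable (lborel_vec m)"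
    if "A \<in> range (\<lambda>(a, b). {a<..b::real})" for A using that by auto
  have "emeasure (root_kernel m q) UNIV = (SUP i. emeasure (root_kernel m q) {- real i<..real i})" for q
  proof -
    have "(\<Union>i. {- real i<..real i}) = UNIV"
    proof (intro equalityI subsetI UNIV_I)
      fix x :: real
      obtain i where "\<bar>x\<bar> < real i" using reals_Archimedean2 by blast
      then show "x \<in> (\<Union>i. {- real i<..real i})" by (intro UN_I[of i]) auto
    qed
    moreover have "incseq (\<lambda>i. {- real i<..real i})" by (auto simp: incseq_def)
    ultimately show ?thesis by (subst SUP_emeasure_incseq) auto
  qed
  with Ioc show "(\<lambda>a. emeasure (root_kernel m (vec_poly m a)) UNIV) \<in> borel_measurable (lborel_vec m)"
    by simp
qed auto

text \<open>The sum equals \<open>Suc m\<close> times an integral against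
  \<open>root_kernel\<close>, and integrals of jointly measurable functions against a measurable
  kernel are measurable.\<close>

lemma borel_measurable_sum_real_roots:
  assumes L[measurable]: "L \<in> N \<rightarrow>\<^sub>M lborel_vec m"
    and g[measurable]: "(\<lambda>(w, x). g w x) \<in> borel_measurable (N \<Otimes>\<^sub>M borel)"
  shows "(\<lambda>w. \<Sum>x\<in>real_roots (vec_poly m (L w)). g w x :: ennreal) \<in> borel_measurable N"
proof -
  have "(\<lambda>w. root_kernel m (vec_poly m (L w))) \<in> N \<rightarrow>\<^sub>M subprob_algebra borel"
    by measurable
  from nn_integral_measurable_subprob_algebra2[OF g this]
  have "(\<lambda>w. ennreal (real (Suc m)) * (\<integral>\<^sup>+x. g w x \<partial>root_kernel m (vec_poly m (L w)))) \<in> borel_measurable N"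
    by measurable
  moreover have "ennreal (real (Suc m)) * (\<integral>\<^sup>+x. g w x \<partial>root_kernel m (vec_poly m (L w)))
      = (\<Sum>x\<in>real_roots (vec_poly m (L w)). g w x)" if "w \<in> space N" for w
  proof -
    have "g w \<in> borel_measurable borel" using that by measurable
    then show ?thesis
      by (simp add: nn_integral_root_kernel mult.assoc[symmetric] ennreal_mult[symmetric] del: of_nat_Suc)
  qed
  ultimately show ?thesis by (simp cong: measurable_cong)
qed

section \<open>The area formula for one root\<close>

lemma image_Ioc_strict_mono:
  fixes g :: "real \<Rightarrow> real"
  assumes "a < b" and cont: "continuous_on {a..b} g"
    and mono: "\<And>x y. a \<le> x \<Longrightarrow> x < y \<Longrightarrow> y \<le> b \<Longrightarrow> g x < g y"
  shows "g ` {a<..b} = {g a<..g b}"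
proof (intro equalityI subsetI)
  fix y assume "y \<in> g ` {a<..b}"
  then obtain x where x: "a < x" "x \<le> b" "y = g x" by auto
  then show "y \<in> {g a<..g b}" using mono[of a x] mono[of x b] by (cases "x = b") auto
next
  fix y assume y: "y \<in> {g a<..g b}"
  then obtain x where "a \<le> x" "x \<le> b" "g x = y"
    using IVT'[of g a y b] assms(1) cont by auto
  with y show "y \<in> g ` {a<..b}" by (intro image_eqI[of _ _ x]) (auto simp: less_le)
qed

text \<open>Splitting the interval at a critical point reduces this to the strictly monotone case.\<close>
lemma nn_integral_card_real_roots_Ioc:
  assumes q: "q \<noteq> 0" and "a \<le> b"
  shows "(\<integral>\<^sup>+c. of_nat (card (real_roots (pCons c q) \<inter> {a<..b})) \<partial>lborel) =
    (\<integral>\<^sup>+x. ennreal \<bar>poly (pderiv (pCons 0 q)) x\<bar> * indicator {a<..b} x \<partial>lborel)"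
  using \<open>a \<le> b\<close>
proof (induction "card {x \<in> {a<..<b}. poly (pderiv (pCons 0 q)) x = 0}" arbitrary: a b rule: less_induct)
  case less
  \<comment> \<open>\<open>F x\<close> is \<open>x * poly q x\<close>, so \<open>x\<close> is a root
    of \<open>pCons c q\<close> exactly when \<open>F x = - c\<close>.\<close>
  define F where "F = poly (pCons 0 q)"
  define F' where "F' = poly (pderiv (pCons 0 q))"
  have DF: "(F has_real_derivative F' x) (at x)" for x by (simp add: F_def F'_def poly_DERIV)
  have "pderiv (pCons 0 q) \<noteq> 0"
    using q by (simp add: pderiv_eq_0_iff degree_pCons_eq_if)
  then have fin: "finite {x. F' x = 0}" by (simp add: F'_def poly_roots_finite)
  obtain L where L: "L \<in> borel \<rightarrow>\<^sub>M lborel_vec (Suc (degree q))" "\<And>c. vec_poly (Suc (degree q)) (L c) = pCons c q"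
    using pCons_eq_vec_poly_measurable by blast
  have card: "(\<lambda>c. card (real_roots (pCons c q) \<inter> {u<..v})) \<in> borel \<rightarrow>\<^sub>M count_space UNIV" for u v
    using measurable_compose[OF L(1) measurable_card_real_roots] by (simp add: L(2))
  consider "a = b" | "a < b" "\<forall>x\<in>{a<..<b}. F' x \<noteq> 0" | e where "a < e" "e < b" "F' e = 0"
    using less.prems by fastforce
  then show ?case
  proof cases
    case 1
    then show ?thesis by simp
  next
    case 2
    \<comment> \<open>With no critical point inside, the intermediate value theorem gives
      \<open>F'\<close> one sign there; \<open>s\<close> records it, and \<open>s * F\<close> is
      increasing.\<close>
    have "\<exists>s\<in>{1,-1}. \<forall>x\<in>{a<..<b}. 0 < s * F' x"
    proof (rule ccontr)
      assume "\<not> ?thesis"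
      then obtain x y where xy: "x \<in> {a<..<b}" "y \<in> {a<..<b}" "F' x \<le> 0" "0 \<le> F' y" by (force simp: not_less)
      then have xy': "F' x < 0" "0 < F' y" using 2(2) by (auto simp: less_le)
      then have "x \<noteq> y" by auto
      then consider "x < y" | "y < x" by linarith
      then have "\<exists>z. min x y < z \<and> z < max x y \<and> F' z = 0"
      proof cases
        case 1
        then show ?thesis
          using poly_IVT_pos[of x y "pderiv (pCons 0 q)"] xy' unfolding F'_def by simp
      next
        case 2
        then show ?thesis
          using poly_IVT_neg[of y x "pderiv (pCons 0 q)"] xy' unfolding F'_def by simp
      qed
      then show False using 2(2) xy(1,2) by (auto simp: min_def max_def split: if_splits)
    qed
    then obtain s where s: "s \<in> {1,-1}" "\<And>x. a < x \<Longrightarrow> x < b \<Longrightarrow> 0 < s * F' x"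
      by (metis greaterThanLessThan_iff)
    define g where "g x = s * F x" for x
    have Dg: "(g has_real_derivative s * F' x) (at x)" for x
      unfolding g_def[abs_def] by (intro DERIV_cmult DF)
    have contg: "continuous_on {u..v} g" for u v
      by (intro DERIV_continuous_on[OF has_field_derivative_at_within[OF Dg]])
    have mono: "g x < g y" if "a \<le> x" "x < y" "y \<le> b" for x y
    proof (rule DERIV_pos_imp_increasing_open[OF \<open>x < y\<close>])
      fix z assume "x < z" "z < y"
      then show "\<exists>d. DERIV g z :> d \<and> 0 < d"
        using that by (intro exI[of _ "s * F' z"] conjI Dg s(2)) auto
    qed (rule contg)
    have img: "g ` {a<..b} = {g a<..g b}"
      by (rule image_Ioc_strict_mono[OF 2(1) contg mono])
    \<comment> \<open>An increasing \<open>g\<close> takes the value \<open>- s * c\<close> at most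
      once, and it does so iff that value lies in the image of the interval. The root count is
      therefore an indicator.\<close>
    have "of_nat (card (real_roots (pCons c q) \<inter> {a<..b})) = (indicator {g a<..g b} (- s * c) :: ennreal)" for c
    proof (cases "\<exists>x\<in>{a<..b}. g x = - s * c")
      case True
      then obtain x where x: "x \<in> {a<..b}" "g x = - s * c" by auto
      have "y = x" if "y \<in> {a<..b}" "g y = - s * c" for y
        using mono[of x y] mono[of y x] that x by (cases x y rule: linorder_cases) auto
      moreover have "real_roots (pCons c q) = {y. g y = - s * c}"
        using s(1) q by (auto simp: real_roots_def g_def F_def)
      ultimately have "real_roots (pCons c q) \<inter> {a<..b} = {x}" using x by blast
      moreover have "- s * c \<in> {g a<..g b}" using x img by (metis image_eqI)
      ultimately show ?thesis by simp
    next
      case False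
      moreover have "real_roots (pCons c q) = {y. g y = - s * c}"
        using s(1) q by (auto simp: real_roots_def g_def F_def)
      ultimately have "real_roots (pCons c q) \<inter> {a<..b} = {}" by blast
      moreover have "- s * c \<notin> {g a<..g b}" using False img by (metis imageE)
      ultimately show ?thesis by simp
    qed
    then have "(\<integral>\<^sup>+c. of_nat (card (real_roots (pCons c q) \<inter> {a<..b})) \<partial>lborel) =
        (\<integral>\<^sup>+c. indicator {g a<..g b} (0 + (- s) * c) \<partial>lborel)" by simp
    \<comment> \<open>The inserted factor is 1; it brings the integral into the form of an affine
      substitution.\<close>
    also have "\<dots> = ennreal \<bar>- s\<bar> * (\<integral>\<^sup>+c. indicator {g a<..g b} (0 + (- s) * c) \<partial>lborel)"
      using s(1) by auto
    also have "\<dots> = (\<integral>\<^sup>+c. indicator {g a<..g b} c \<partial>lborel)"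
      using s(1) by (intro nn_integral_real_affine[symmetric]) auto
    also have "\<dots> = ennreal (g b - g a)"
      using mono[of a b] 2(1) by simp
    also have "\<dots> = (\<integral>\<^sup>+x. ennreal (s * F' x) * indicator {a..b} x \<partial>lborel)"
    proof (rule nn_integral_FTC_Icc[symmetric])
      show "(\<lambda>x. s * F' x) \<in> borel_measurable borel" unfolding F'_def by measurable
      show "(g has_real_derivative s * F' x) (at x)" for x by (rule Dg)
      \<comment> \<open>The sign is known on the open interval; continuity carries the weak
        inequality to the end points.\<close>
      show "0 \<le> s * F' x" if "x \<in> {a..b}" for x
      proof (rule continuous_ge_on_closure[of "{a<..<b}" "\<lambda>x. s * F' x"])
        show "continuous_on (closure {a<..<b}) (\<lambda>x. s * F' x)"
          unfolding F'_def by (intro continuous_intros)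
        show "x \<in> closure {a<..<b}" using that 2(1) by simp
        show "0 \<le> s * F' y" if "y \<in> {a<..<b}" for y
          using s(2) that by (auto intro: less_imp_le)
      qed
    qed (use 2 in simp)
    also have "\<dots> = (\<integral>\<^sup>+x. ennreal \<bar>F' x\<bar> * indicator {a<..b} x \<partial>lborel)"
    proof (rule nn_integral_cong_AE)
      have "AE x in lborel. x \<noteq> a \<and> x \<noteq> b" by (intro AE_conjI AE_lborel_singleton)
      then show "AE x in lborel. ennreal (s * F' x) * indicator {a..b} x = ennreal \<bar>F' x\<bar> * indicator {a<..b} x"
      proof eventually_elim
        case (elim x)
        have "s * F' x = \<bar>F' x\<bar>" if "a < x" "x < b" using s(1) s(2)[OF that] by auto
        with elim show ?case by (auto simp: indicator_def)
      qed
    qed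
    finally show ?thesis by (simp add: F'_def)
  next
    case 3
    \<comment> \<open>The critical point \<open>e\<close> lies in neither of the two open parts, so
      both have fewer critical points and the induction hypothesis applies.\<close>
    have split: "{a<..b} = {a<..e} \<union> {e<..b}" using 3 by auto
    have fin': "finite {x \<in> {u<..<v}. F' x = 0}" for u v
      by (rule finite_subset[OF _ fin]) auto
    have "card (real_roots (pCons c q) \<inter> {a<..b}) =
        card (real_roots (pCons c q) \<inter> {a<..e}) + card (real_roots (pCons c q) \<inter> {e<..b})" for c
      unfolding split Int_Un_distrib by (rule card_Un_disjoint) auto
    then have "(\<integral>\<^sup>+c. of_nat (card (real_roots (pCons c q) \<inter> {a<..b})) \<partial>lborel) =
        (\<integral>\<^sup>+c. of_nat (card (real_roots (pCons c q) \<inter> {a<..e})) \<partial>lborel) +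
        (\<integral>\<^sup>+c. of_nat (card (real_roots (pCons c q) \<inter> {e<..b})) \<partial>lborel)"
      using card by (simp add: nn_integral_add)
    also have "(\<integral>\<^sup>+c. of_nat (card (real_roots (pCons c q) \<inter> {a<..e})) \<partial>lborel) =
        (\<integral>\<^sup>+x. ennreal \<bar>F' x\<bar> * indicator {a<..e} x \<partial>lborel)"
      unfolding F'_def
    proof (rule less.hyps)
      have "e \<in> {x \<in> {a<..<b}. F' x = 0} - {x \<in> {a<..<e}. F' x = 0}" using 3 by auto
      then have "{x \<in> {a<..<e}. F' x = 0} \<subset> {x \<in> {a<..<b}. F' x = 0}" using 3 by auto
      then show "card {x \<in> {a<..<e}. poly (pderiv (pCons 0 q)) x = 0} < card {x \<in> {a<..<b}. poly (pderiv (pCons 0 q)) x = 0}"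
        using fin'[of a b] by (auto simp: F'_def intro: psubset_card_mono)
    qed (use 3 in simp)
    also have "(\<integral>\<^sup>+c. of_nat (card (real_roots (pCons c q) \<inter> {e<..b})) \<partial>lborel) =
        (\<integral>\<^sup>+x. ennreal \<bar>F' x\<bar> * indicator {e<..b} x \<partial>lborel)"
      unfolding F'_def
    proof (rule less.hyps)
      have "e \<in> {x \<in> {a<..<b}. F' x = 0} - {x \<in> {e<..<b}. F' x = 0}" using 3 by auto
      then have "{x \<in> {e<..<b}. F' x = 0} \<subset> {x \<in> {a<..<b}. F' x = 0}" using 3 by auto
      then show "card {x \<in> {e<..<b}. poly (pderiv (pCons 0 q)) x = 0} < card {x \<in> {a<..<b}. poly (pderiv (pCons 0 q)) x = 0}"
        using fin'[of a b] by (auto simp: F'_def intro: psubset_card_mono)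
    qed (use 3 in simp)
    also have "(\<integral>\<^sup>+x. ennreal \<bar>F' x\<bar> * indicator {a<..e} x \<partial>lborel) + (\<integral>\<^sup>+x. ennreal \<bar>F' x\<bar> * indicator {e<..b} x \<partial>lborel)
        = (\<integral>\<^sup>+x. ennreal \<bar>F' x\<bar> * indicator {a<..b} x \<partial>lborel)"
    proof (subst nn_integral_add[symmetric])
      show "(\<integral>\<^sup>+x. ennreal \<bar>F' x\<bar> * indicator {a<..e} x + ennreal \<bar>F' x\<bar> * indicator {e<..b} x \<partial>lborel)
        = (\<integral>\<^sup>+x. ennreal \<bar>F' x\<bar> * indicator {a<..b} x \<partial>lborel)"
        using 3 by (intro nn_integral_cong) (auto simp: indicator_def)
    qed (auto simp: F'_def)
    finally show ?thesis by (simp add: F'_def)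
  qed
qed

text \<open>Both sides are, up to normalisation, integrals of \<open>H\<close> against measures: the
  mixture \<open>lborel \<bind> K\<close> of root kernels, and the measure with density proportional
  to the modulus of the derivative. The integrated root counts say that these agree on intervals,
  hence everywhere.\<close>

lemma nn_integral_sum_real_roots_pCons:
  assumes H[measurable]: "H \<in> borel_measurable borel"
  shows "(\<integral>\<^sup>+c. (\<Sum>x\<in>real_roots (pCons c q). H x) \<partial>lborel) =
    (\<integral>\<^sup>+x. H x * ennreal \<bar>poly (pderiv (pCons 0 q)) x\<bar> \<partial>lborel)"
proof (cases "q = 0")
  case True
  \<comment> \<open>A nonzero constant has no roots, and for \<open>c = 0\<close> the convention in
    \<open>real_roots\<close> applies.\<close>
  have "real_roots (pCons c 0) = {}" for c by (simp add: real_roots_def)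
  with True show ?thesis by simp
next
  case False
  define m where "m = Suc (degree q)"
  define D where "D x = ennreal \<bar>poly (pderiv (pCons 0 q)) x\<bar>" for x
  have [measurable]: "D \<in> borel_measurable borel" unfolding D_def[abs_def] by measurable
  \<comment> \<open>The normalisation of the kernel; it is finite and nonzero, hence can be
    cancelled at the end.\<close>
  define k where "k = ennreal (1 / real (Suc m))"
  have k: "ennreal (real (Suc m)) * (k * x) = x" for x
    by (simp add: k_def mult.assoc[symmetric] ennreal_mult[symmetric] del: of_nat_Suc)
  obtain L where L[measurable]: "L \<in> borel \<rightarrow>\<^sub>M lborel_vec m" and L_eq: "\<And>c. vec_poly m (L c) = pCons c q"
    using pCons_eq_vec_poly_measurable[of q] unfolding m_def by blast
  define K where "K c = root_kernel m (pCons c q)" for c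
  have K: "K \<in> lborel \<rightarrow>\<^sub>M subprob_algebra borel"
    using measurable_compose[OF L measurable_root_kernel[of m]] by (simp add: L_eq K_def[abs_def])
  have "density lborel (\<lambda>x. k * D x) = lborel \<bind> K"
  proof (rule measure_eqI_generator_eq[OF Int_stable_Ioc])
    fix X assume "X \<in> range (\<lambda>(a, b). {a<..b::real})"
    then obtain a b where X: "X = {a<..b}" by auto
    have card[measurable]: "(\<lambda>c. card (real_roots (pCons c q) \<inter> X)) \<in> borel \<rightarrow>\<^sub>M count_space UNIV"
      using measurable_compose[OF L measurable_card_real_roots] by (simp add: L_eq X)
    show "emeasure (density lborel (\<lambda>x. k * D x)) X = emeasure (lborel \<bind> K) X"
    proof (cases "a \<le> b")
      case True
      have "emeasure (density lborel (\<lambda>x. k * D x)) X = (\<integral>\<^sup>+x. k * (D x * indicator X x) \<partial>lborel)"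
        by (simp add: X emeasure_density mult.assoc)
      also have "\<dots> = k * (\<integral>\<^sup>+x. D x * indicator X x \<partial>lborel)"
        by (rule nn_integral_cmult) (simp add: X)
      also have "\<dots> = k * (\<integral>\<^sup>+c. of_nat (card (real_roots (pCons c q) \<inter> X)) \<partial>lborel)"
        using nn_integral_card_real_roots_Ioc[OF False True] by (simp add: D_def X)
      also have "\<dots> = (\<integral>\<^sup>+c. k * of_nat (card (real_roots (pCons c q) \<inter> X)) \<partial>lborel)"
        by (rule nn_integral_cmult[symmetric]) simp
      also have "\<dots> = (\<integral>\<^sup>+c. emeasure (K c) X \<partial>lborel)"
        by (simp add: K_def X emeasure_root_kernel k_def)
      also have "\<dots> = emeasure (lborel \<bind> K) X"
        by (rule emeasure_bind[OF _ K, symmetric]) (auto simp: X)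
      finally show ?thesis .
    qed (simp add: X)
  next
    show "sets (lborel \<bind> K) = sigma_sets UNIV (range (\<lambda>(a, b). {a<..b::real}))"
      by (subst sets_bind[where N=borel]) (simp_all add: K_def sets_borel_eq_sigma_sets_Ioc)
    show "range (\<lambda>i::nat. {- real i<..real i}) \<subseteq> range (\<lambda>(a, b). {a<..b::real})" by auto
    show "(\<Union>i::nat. {- real i<..real i}) = UNIV"
    proof (intro equalityI subsetI UNIV_I)
      fix x :: real
      obtain i where "\<bar>x\<bar> < real i" using reals_Archimedean2 by blast
      then show "x \<in> (\<Union>i::nat. {- real i<..real i})" by (intro UN_I[of i]) auto
    qed
    fix i :: nat
    let ?A = "{- real i<..real i}"
    \<comment> \<open>Uniqueness from a generator requires finite mass along an exhausting sequence;
      the polynomial density is bounded on bounded intervals.\<close>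
    have "compact (poly (pderiv (pCons 0 q)) ` {- real i..real i})"
      by (intro compact_continuous_image continuous_intros) auto
    then have "bounded (poly (pderiv (pCons 0 q)) ` {- real i..real i})" by (rule compact_imp_bounded)
    then obtain B where B': "\<forall>y\<in>poly (pderiv (pCons 0 q)) ` {- real i..real i}. norm y \<le> B"
      unfolding bounded_iff ..
    have B: "\<bar>poly (pderiv (pCons 0 q)) x\<bar> \<le> B" if "x \<in> ?A" for x
      using bspec[OF B', OF imageI, of x] that by simp
    have "emeasure (density lborel (\<lambda>x. k * D x)) ?A = (\<integral>\<^sup>+x. k * D x * indicator ?A x \<partial>lborel)"
      by (simp add: emeasure_density)
    also have "\<dots> \<le> (\<integral>\<^sup>+x. k * ennreal B * indicator ?A x \<partial>lborel)"
      using B by (intro nn_integral_mono) (auto simp: D_def indicator_def intro!: mult_left_mono ennreal_leI)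
    also have "\<dots> < \<infinity>"
      by (simp add: nn_integral_cmult_indicator k_def ennreal_mult_less_top)
    finally show "emeasure (density lborel (\<lambda>x. k * D x)) ?A \<noteq> \<infinity>" by simp
  qed (auto simp: sets_borel_eq_sigma_sets_Ioc)
  then have "(\<integral>\<^sup>+x. H x \<partial>(lborel \<bind> K)) = (\<integral>\<^sup>+x. H x \<partial>density lborel (\<lambda>x. k * D x))" by simp
  moreover have "(\<integral>\<^sup>+x. H x \<partial>(lborel \<bind> K)) = (\<integral>\<^sup>+c. k * (\<Sum>x\<in>real_roots (pCons c q). H x) \<partial>lborel)"
    by (simp add: nn_integral_bind[OF H K] K_def nn_integral_root_kernel k_def)
  moreover have "(\<lambda>c. \<Sum>x\<in>real_roots (vec_poly m (L c)). H x) \<in> borel_measurable lborel"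
    by (rule borel_measurable_sum_real_roots) measurable
  then have "(\<integral>\<^sup>+c. k * (\<Sum>x\<in>real_roots (pCons c q). H x) \<partial>lborel) =
      k * (\<integral>\<^sup>+c. (\<Sum>x\<in>real_roots (pCons c q). H x) \<partial>lborel)"
    by (intro nn_integral_cmult) (simp add: L_eq)
  moreover have "(\<integral>\<^sup>+x. H x \<partial>density lborel (\<lambda>x. k * D x)) = k * (\<integral>\<^sup>+x. H x * D x \<partial>lborel)"
    by (subst nn_integral_density) (simp_all add: nn_integral_cmult[symmetric] mult_ac)
  ultimately have "k * (\<integral>\<^sup>+c. (\<Sum>x\<in>real_roots (pCons c q). H x) \<partial>lborel) = k * (\<integral>\<^sup>+x. H x * D x \<partial>lborel)"
    by simp
  then show ?thesis using k unfolding D_def by metis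
qed

section \<open>Dividing out a known root\<close>

definition coeff_vec :: "nat \<Rightarrow> real poly \<Rightarrow> nat \<Rightarrow> real" where
  "coeff_vec m q = restrict (coeff q) {..m}"

lemma vec_poly_coeff_vec: "degree q \<le> m \<Longrightarrow> vec_poly m (coeff_vec m q) = q"
  by (rule poly_eqI) (auto simp: coeff_vec_poly coeff_vec_def coeff_eq_0)

lemma coeff_vec_vec_poly: "t \<in> space (lborel_vec m) \<Longrightarrow> coeff_vec m (vec_poly m t) = t"
  by (auto simp: coeff_vec_def coeff_vec_poly space_PiM PiE_def extensional_def restrict_def)

lemma coeff_linear_times: "coeff ([:-c, 1:] * q) i = (case i of 0 \<Rightarrow> 0 | Suc j \<Rightarrow> coeff q j) - c * coeff q (i :: nat)"
  for c :: real
  by (simp add: coeff_pCons split: nat.split)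

text \<open>The matrix of multiplication by $y - x$ on coefficient vectors, without the row of the constant coefficient.\<close>
definition deflation :: "real \<Rightarrow> nat \<Rightarrow> nat \<Rightarrow> real" where
  "deflation x l i = (if i = l then 1 else if i = Suc l then - x else 0)"

lemma triangular_map_deflation:
  "triangular_map (deflation x) m b = (\<lambda>l\<in>{..m}. coeff ([:-x, 1:] * vec_poly m b) (Suc l))"
  unfolding triangular_map_def
proof (rule restrict_ext)
  fix l assume l: "l \<in> {..m}"
  have "(\<Sum>i=l..m. deflation x l i * b i) = (\<Sum>i=l..m. (if i = l then b i else 0) + (if i = Suc l then - x * b i else 0))"
    by (rule sum.cong) (auto simp: deflation_def)
  also have "\<dots> = coeff ([:-x, 1:] * vec_poly m b) (Suc l)"
    using l by (simp only: sum.distrib coeff_linear_times) (simp add: coeff_vec_poly)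
  finally show "(\<Sum>i=l..m. deflation x l i * b i) = coeff ([:-x, 1:] * vec_poly m b) (Suc l)" .
qed

lemma linear_times_vec_poly:
  "[:-x, 1:] * vec_poly m b = pCons (- x * b 0) (vec_poly m (triangular_map (deflation x) m b))"
proof (rule poly_eqI)
  fix i
  show "coeff ([:-x, 1:] * vec_poly m b) i = coeff (pCons (- x * b 0) (vec_poly m (triangular_map (deflation x) m b))) i"
  proof (cases i)
    case 0
    then show ?thesis by (simp add: coeff_vec_poly)
  next
    case (Suc l)
    then show ?thesis
      unfolding triangular_map_deflation
      by (simp del: mult_pCons_left add: coeff_vec_poly coeff_linear_times)
  qed
qed

text \<open>A multiple of \<open>y - x\<close> vanishes at \<open>x\<close>, which forces its
  constant coefficient once the others are known. So the point produced by the area formula is the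
  coefficient vector of the factored polynomial.\<close>

lemma case_nat_triangular_map_deflation:
  "case_nat (- x * poly (vec_poly m (triangular_map (deflation x) m b)) x) (triangular_map (deflation x) m b)
    = coeff_vec (Suc m) ([:-x, 1:] * vec_poly m b)"
proof -
  have "poly ([:-x, 1:] * vec_poly m b) x = 0" by simp
  then have "- x * poly (vec_poly m (triangular_map (deflation x) m b)) x = coeff ([:-x, 1:] * vec_poly m b) 0"
    unfolding linear_times_vec_poly by simp
  then show ?thesis
    by (auto simp del: mult_pCons_left simp: coeff_vec_def triangular_map_deflation restrict_def split: nat.splits)
qed

text \<open>The derivative does not see the constant coefficient, so it may be computed on the
  factored polynomial, where the product rule at \<open>x\<close> leaves only the quotient. This
  turns the density of the area formula into the modulus of the quotient at the root.\<close>

lemma poly_pderiv_deflation: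
  "poly (pderiv (pCons 0 (vec_poly m (triangular_map (deflation x) m b)))) x = poly (vec_poly m b) x"
proof -
  have "pderiv (pCons 0 q) = pderiv (pCons c q)" for c :: real and q by (simp add: pderiv_pCons)
  then have "pderiv (pCons 0 (vec_poly m (triangular_map (deflation x) m b))) = pderiv ([:-x, 1:] * vec_poly m b)"
    by (metis linear_times_vec_poly)
  then show ?thesis by (simp del: mult_pCons_left add: pderiv_mult pderiv_pCons)
qed

lemma borel_measurable_poly_pderiv_vec_poly [measurable]:
  assumes [measurable]: "L \<in> N \<rightarrow>\<^sub>M lborel_vec m" "y \<in> borel_measurable N"
  shows "(\<lambda>w. poly (pderiv (vec_poly m (L w))) (y w)) \<in> borel_measurable N"
proof -
  have "poly (pderiv (vec_poly m a)) x = (\<Sum>i\<le>m. real i * a i * x ^ (i - 1))" for a x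
    by (induction m) (simp_all add: vec_poly_def pderiv_add pderiv_monom poly_monom)
  then show ?thesis
    by (auto intro!: borel_measurable_sum borel_measurable_times borel_measurable_power
      measurable_lborel_vec_component[OF assms(1)])
qed

lemma measurable_case_nat_vec' [measurable]:
  assumes "f \<in> borel_measurable N" "g \<in> N \<rightarrow>\<^sub>M lborel_vec m"
  shows "(\<lambda>w. case_nat (f w) (g w)) \<in> N \<rightarrow>\<^sub>M lborel_vec (Suc m)"
proof -
  have "(\<lambda>w. (g w, f w)) \<in> N \<rightarrow>\<^sub>M lborel_vec m \<Otimes>\<^sub>M lborel" using assms by simp
  from measurable_compose[OF this measurable_case_nat_vec] show ?thesis by simp
qed

lemma nn_integral_sum_real_roots:
  assumes H: "(\<lambda>(a, x). H a x) \<in> borel_measurable (lborel_vec (Suc m) \<Otimes>\<^sub>M borel)"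
  shows "(\<integral>\<^sup>+a. (\<Sum>x\<in>real_roots (vec_poly (Suc m) a). H a x) \<partial>lborel_vec (Suc m)) =
    (\<integral>\<^sup>+x. \<integral>\<^sup>+b. H (coeff_vec (Suc m) ([:-x, 1:] * vec_poly m b)) x * ennreal \<bar>poly (vec_poly m b) x\<bar>
      \<partial>lborel_vec m \<partial>lborel)"
proof -
  interpret V: finite_product_sigma_finite "\<lambda>_::nat. lborel :: real measure" "{..m}" by standard simp
  interpret P: pair_sigma_finite "lborel_vec m" "lborel :: real measure" ..
  \<comment> \<open>The one-variable formula needs an integrand that does not depend on
    \<open>c\<close>. On the root set \<open>c\<close> is determined by \<open>a\<close> and
    \<open>x\<close>, so it can be eliminated.\<close>
  define H' where "H' a x = H (case_nat (- x * poly (vec_poly m a) x) a) x" for a x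
  define D where "D a x = ennreal \<bar>poly (pderiv (pCons 0 (vec_poly m a))) x\<bar>" for a x
  have Hm: "(\<lambda>w. H (f w) (g w)) \<in> borel_measurable N"
    if "f \<in> N \<rightarrow>\<^sub>M lborel_vec (Suc m)" "g \<in> borel_measurable N" for f g and N :: "'b measure"
  proof -
    have "(\<lambda>w. (f w, g w)) \<in> N \<rightarrow>\<^sub>M lborel_vec (Suc m) \<Otimes>\<^sub>M borel" using that by simp
    from measurable_compose[OF this H] show ?thesis by simp
  qed
  have H'm[measurable]: "(\<lambda>(a, x). H' a x) \<in> borel_measurable (lborel_vec m \<Otimes>\<^sub>M lborel)"
    unfolding H'_def case_prod_beta by (intro Hm) measurable
  have Dm[measurable]: "(\<lambda>(a, x). D a x) \<in> borel_measurable (lborel_vec m \<Otimes>\<^sub>M lborel)"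
    unfolding D_def case_prod_beta pderiv_pCons by simp
  have sum: "(\<Sum>x\<in>real_roots (vec_poly (Suc m) (case_nat c a)). H (case_nat c a) x) =
      (\<Sum>x\<in>real_roots (pCons c (vec_poly m a)). H' a x)" for a c
    unfolding vec_poly_case_nat
    by (rule sum.cong) (auto simp: real_roots_def H'_def add_eq_0_iff2 split: if_splits)
  have "(\<integral>\<^sup>+a. (\<Sum>x\<in>real_roots (vec_poly (Suc m) a). H a x) \<partial>lborel_vec (Suc m)) =
      (\<integral>\<^sup>+a. \<integral>\<^sup>+c. (\<Sum>x\<in>real_roots (pCons c (vec_poly m a)). H' a x) \<partial>lborel \<partial>lborel_vec m)"
    by (subst nn_integral_lborel_vec_Suc) (auto simp: sum intro!: borel_measurable_sum_real_roots H)
  also have "\<dots> = (\<integral>\<^sup>+a. \<integral>\<^sup>+x. H' a x * D a x \<partial>lborel \<partial>lborel_vec m)"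
    unfolding D_def
    by (intro nn_integral_cong nn_integral_sum_real_roots_pCons) (use H'm in \<open>measurable\<close>)
  also have "\<dots> = (\<integral>\<^sup>+x. \<integral>\<^sup>+a. H' a x * D a x \<partial>lborel_vec m \<partial>lborel)"
    by (rule P.Fubini'[symmetric]) measurable
  \<comment> \<open>The substitution depends on \<open>x\<close>, hence the preceding exchange that
    makes \<open>x\<close> the outer variable. The diagonal of \<open>deflation x\<close> is 1, so
    no factor appears.\<close>
  also have "\<dots> = (\<integral>\<^sup>+x. \<integral>\<^sup>+b. H' (triangular_map (deflation x) m b) x * D (triangular_map (deflation x) m b) x
      \<partial>lborel_vec m \<partial>lborel)"
  proof (rule nn_integral_cong)
    fix x :: real
    have "(\<lambda>a. H' a x * D a x) \<in> borel_measurable (lborel_vec m)" by measurable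
    from nn_integral_triangular_map[OF _ this, of "deflation x"]
    show "(\<integral>\<^sup>+a. H' a x * D a x \<partial>lborel_vec m) =
        (\<integral>\<^sup>+b. H' (triangular_map (deflation x) m b) x * D (triangular_map (deflation x) m b) x \<partial>lborel_vec m)"
      by (simp add: deflation_def[of _ l l for l])
  qed
  also have "\<dots> = (\<integral>\<^sup>+x. \<integral>\<^sup>+b. H (coeff_vec (Suc m) ([:-x, 1:] * vec_poly m b)) x * ennreal \<bar>poly (vec_poly m b) x\<bar>
      \<partial>lborel_vec m \<partial>lborel)"
    unfolding H'_def D_def case_nat_triangular_map_deflation poly_pderiv_deflation ..
  finally show ?thesis .
qed

section \<open>Summing over tuples of distinct roots\<close>

text \<open>Finite for every \<open>q\<close>, unlike \<open>zero_tuples\<close>; the two differ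
  only for the zero polynomial, and there only when \<open>k\<close> is positive.\<close>

definition root_tuples :: "nat \<Rightarrow> real poly \<Rightarrow> (nat \<Rightarrow> real) set" where
  "root_tuples k q = {x \<in> PiE {1..k} (\<lambda>_. UNIV). inj_on x {1..k} \<and> (\<forall>i\<in>{1..k}. x i \<in> real_roots q)}"

definition node_poly :: "nat \<Rightarrow> (nat \<Rightarrow> real) \<Rightarrow> real poly" where
  "node_poly k x = (\<Prod>i\<in>{1..k}. [:- x i, 1:])"

text \<open>The Jacobian accumulated over \<open>k\<close> deflations: a Vandermonde product times
  the values of the final quotient \<open>q\<close> at the nodes.\<close>

definition root_weight :: "nat \<Rightarrow> (nat \<Rightarrow> real) \<Rightarrow> real poly \<Rightarrow> real" where
  "root_weight k x q = (\<Prod>i\<in>{1..k}. \<Prod>j\<in>{i<..k}. \<bar>x i - x j\<bar>) * (\<Prod>i\<in>{1..k}. \<bar>poly q (x i)\<bar>)"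

abbreviation node_space :: "nat \<Rightarrow> (nat \<Rightarrow> real) measure" where
  "node_space k \<equiv> PiM {1..k} (\<lambda>_. lborel)"

lemma root_tuples_subset: "root_tuples k q \<subseteq> PiE {1..k} (\<lambda>_. real_roots q)"
  by (auto simp: root_tuples_def PiE_def)

lemma finite_root_tuples [simp, intro]: "finite (root_tuples k q)"
  by (rule finite_subset[OF root_tuples_subset]) (auto intro: finite_PiE)

lemma card_root_tuples_le: "card (root_tuples k q) \<le> degree q ^ k"
proof -
  have "card (root_tuples k q) \<le> card (PiE {1..k} (\<lambda>_. real_roots q))"
    by (rule card_mono[OF _ root_tuples_subset]) (auto intro: finite_PiE)
  also have "\<dots> = card (real_roots q) ^ k" by (simp add: card_PiE)
  also have "\<dots> \<le> degree q ^ k" by (intro power_mono card_real_roots_le) simp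
  finally show ?thesis .
qed

lemma root_tuples_0: "root_tuples 0 q = {\<lambda>_. undefined}"
  by (auto simp: root_tuples_def)

lemma atLeastAtMost_insert_Suc: "{1..Suc k} = insert (Suc k) {1..k}"
  by auto

lemma node_poly_Suc: "node_poly (Suc k) x = [:- x (Suc k), 1:] * node_poly k x"
  by (simp add: node_poly_def mult.commute)

lemma node_poly_upd: "node_poly (Suc k) (x(Suc k := y)) = [:- y, 1:] * node_poly k x"
proof -
  have "node_poly k (x(Suc k := y)) = node_poly k x"
    unfolding node_poly_def by (rule prod.cong) auto
  then show ?thesis by (simp add: node_poly_Suc)
qed

lemma node_poly_ne_0: "node_poly k x \<noteq> 0"
  by (simp add: node_poly_def)

lemma degree_node_poly: "degree (node_poly k x) = k"
  by (simp add: node_poly_def degree_prod_eq_sum_degree)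

lemma poly_node_poly: "poly (node_poly k x) y = (\<Prod>i\<in>{1..k}. y - x i)"
  by (simp add: node_poly_def poly_prod)

text \<open>Distinctness from the earlier nodes becomes a factor 0 or 1, so the inner sum still runs
  over all of \<open>real_roots q\<close>. This is the form required by the area formula and by the
  measurability result.\<close>

lemma sum_root_tuples_Suc:
  fixes F :: "(nat \<Rightarrow> real) \<Rightarrow> ennreal"
  shows "(\<Sum>x\<in>root_tuples (Suc k) q. F x) =
    (\<Sum>x\<in>root_tuples k q. \<Sum>y\<in>real_roots q. (\<Prod>i\<in>{1..k}. if y = x i then 0 else 1) * F (x(Suc k := y)))"
proof -
  have "(\<Sum>y\<in>real_roots q. (\<Prod>i\<in>{1..k}. if y = x i then 0 else 1) * F (x(Suc k := y))) =
      (\<Sum>y\<in>real_roots q - x ` {1..k}. F (x(Suc k := y)))" for x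
  proof (rule sum.mono_neutral_cong_right)
    show "\<forall>y\<in>real_roots q - (real_roots q - x ` {1..k}). (\<Prod>i\<in>{1..k}. if y = x i then 0 else 1) * F (x(Suc k := y)) = 0"
    proof
      fix y assume "y \<in> real_roots q - (real_roots q - x ` {1..k})"
      then have "(\<Prod>i\<in>{1..k}. if y = x i then 0 else 1 :: ennreal) = 0"
        by (intro prod_zero) auto
      then show "(\<Prod>i\<in>{1..k}. if y = x i then 0 else 1) * F (x(Suc k := y)) = 0" by simp
    qed
    show "(\<Prod>i\<in>{1..k}. if y = x i then 0 else 1) * F (x(Suc k := y)) = F (x(Suc k := y))"
      if "y \<in> real_roots q - x ` {1..k}" for y
    proof -
      have "(\<Prod>i\<in>{1..k}. if y = x i then 0 else 1 :: ennreal) = 1"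
        using that by (intro prod.neutral) auto
      then show ?thesis by simp
    qed
  qed auto
  then have "(\<Sum>x\<in>root_tuples k q. \<Sum>y\<in>real_roots q. (\<Prod>i\<in>{1..k}. if y = x i then 0 else 1) * F (x(Suc k := y))) =
      (\<Sum>(x, y)\<in>Sigma (root_tuples k q) (\<lambda>x. real_roots q - x ` {1..k}). F (x(Suc k := y)))"
    by (simp add: sum.Sigma)
  also have "\<dots> = (\<Sum>x\<in>root_tuples (Suc k) q. F x)"
  proof (rule sum.reindex_bij_witness[where i="\<lambda>x. (restrict x {1..k}, x (Suc k))" and j="\<lambda>(x, y). x(Suc k := y)"])
    fix w assume w: "w \<in> Sigma (root_tuples k q) (\<lambda>x. real_roots q - x ` {1..k})"
    then obtain x y where [simp]: "w = (x, y)" and x: "x \<in> extensional {1..k}" "inj_on x {1..k}"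
      "\<And>i. i \<in> {1..k} \<Longrightarrow> x i \<in> real_roots q" and y: "y \<in> real_roots q" "y \<notin> x ` {1..k}"
      by (auto simp: root_tuples_def PiE_def)
    show "(restrict ((case w of (x, y) \<Rightarrow> x(Suc k := y))) {1..k}, (case w of (x, y) \<Rightarrow> x(Suc k := y)) (Suc k)) = w"
      using x(1) by (auto simp: extensional_def restrict_def)
    have "inj_on (x(Suc k := y)) {1..k} = inj_on x {1..k}" by (rule inj_on_cong) auto
    moreover have "(x(Suc k := y)) ` ({1..k} - {Suc k}) = x ` {1..k}" by (intro image_cong) auto
    ultimately have "inj_on (x(Suc k := y)) {1..Suc k}"
      unfolding atLeastAtMost_insert_Suc inj_on_insert using x(2) y(2) by simp
    moreover have "(x(Suc k := y)) \<in> extensional {1..Suc k}"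
      using x(1) by (auto simp: extensional_def)
    ultimately show "(case w of (x, y) \<Rightarrow> x(Suc k := y)) \<in> root_tuples (Suc k) q"
      using x(3) y(1) by (auto simp: root_tuples_def PiE_iff)
  next
    fix x assume x: "x \<in> root_tuples (Suc k) q"
    then have x': "x \<in> extensional {1..Suc k}" "inj_on x {1..Suc k}"
      "\<And>i. i \<in> {1..Suc k} \<Longrightarrow> x i \<in> real_roots q"
      by (auto simp: root_tuples_def PiE_def)
    show "(case (restrict x {1..k}, x (Suc k)) of (x, y) \<Rightarrow> x(Suc k := y)) = x"
      using x'(1) by (auto simp: extensional_def restrict_def fun_eq_iff le_Suc_eq)
    have inj: "inj_on x {1..k}" and "x (Suc k) \<notin> x ` ({1..k} - {Suc k})"
      using x'(2) unfolding atLeastAtMost_insert_Suc inj_on_insert by simp_all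
    moreover have "{1..k} - {Suc k} = {1..k}" by auto
    moreover have "inj_on (restrict x {1..k}) {1..k} = inj_on x {1..k}" by (rule inj_on_cong) auto
    moreover have "restrict x {1..k} ` {1..k} = x ` {1..k}" by (intro image_cong) auto
    ultimately show "(restrict x {1..k}, x (Suc k)) \<in> Sigma (root_tuples k q) (\<lambda>x. real_roots q - x ` {1..k})"
      using x'(3) by (simp add: root_tuples_def)
  qed auto
  finally show ?thesis ..
qed

section \<open>Measurable dependence on the nodes\<close>

lemma measurable_node_component:
  assumes "X \<in> N \<rightarrow>\<^sub>M node_space k" and "i \<in> {1..k}"
  shows "(\<lambda>w. X w i) \<in> borel_measurable N"
  using measurable_compose[OF assms(1) measurable_component_singleton[OF assms(2)]] by simp

lemma measurable_node_upd:
  assumes "X \<in> N \<rightarrow>\<^sub>M node_space k" and "y \<in> borel_measurable N"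
  shows "(\<lambda>w. (X w)(Suc k := y w)) \<in> N \<rightarrow>\<^sub>M node_space (Suc k)"
  unfolding atLeastAtMost_insert_Suc using assms by measurable

lemma borel_measurable_avoids_nodes:
  assumes X: "X \<in> N \<rightarrow>\<^sub>M node_space k" and y: "y \<in> borel_measurable N"
  shows "(\<lambda>w. \<Prod>i\<in>{1..k}. if y w = X w i then 0 else 1 :: ennreal) \<in> borel_measurable N"
proof (rule borel_measurable_prod_ennreal)
  fix i assume "i \<in> {1..k}"
  note [measurable] = y measurable_node_component[OF X this]
  show "(\<lambda>w. if y w = X w i then 0 else 1 :: ennreal) \<in> borel_measurable N" by measurable
qed

lemma borel_measurable_sum_root_tuples:
  assumes "L \<in> N \<rightarrow>\<^sub>M lborel_vec m"
    and "(\<lambda>(w, x). F w x) \<in> borel_measurable (N \<Otimes>\<^sub>M node_space k)"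
  shows "(\<lambda>w. \<Sum>x\<in>root_tuples k (vec_poly m (L w)). F w x :: ennreal) \<in> borel_measurable N"
  using assms
proof (induction k arbitrary: F)
  case 0
  have "(\<lambda>w. (w, \<lambda>_. undefined)) \<in> N \<rightarrow>\<^sub>M N \<Otimes>\<^sub>M node_space 0"
    by (intro measurable_Pair measurable_const) (auto simp: space_PiM)
  from measurable_compose[OF this 0(2)] show ?case by (simp add: root_tuples_0)
next
  case (Suc k)
  note L[measurable] = Suc.prems(1)
  have "(\<lambda>(w, x). \<Sum>y\<in>real_roots (vec_poly m (L w)). (\<Prod>i\<in>{1..k}. if y = x i then 0 else 1) * F w (x(Suc k := y)))
      \<in> borel_measurable (N \<Otimes>\<^sub>M node_space k)"
    unfolding case_prod_beta
  proof (rule borel_measurable_sum_real_roots)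
    have "(\<lambda>v. (fst (fst v), (snd (fst v))(Suc k := snd v))) \<in> (N \<Otimes>\<^sub>M node_space k) \<Otimes>\<^sub>M borel \<rightarrow>\<^sub>M N \<Otimes>\<^sub>M node_space (Suc k)"
      by (intro measurable_Pair measurable_node_upd) measurable
    note F = measurable_compose[OF this Suc.prems(2)]
    show "(\<lambda>(v, y). (\<Prod>i\<in>{1..k}. if y = snd v i then 0 else 1) * F (fst v) ((snd v)(Suc k := y)))
        \<in> borel_measurable ((N \<Otimes>\<^sub>M node_space k) \<Otimes>\<^sub>M borel)"
      unfolding case_prod_beta
      by (intro borel_measurable_times_ennreal borel_measurable_avoids_nodes) (use F in simp_all)
  qed measurable
  from Suc.IH[OF L this] show ?case unfolding sum_root_tuples_Suc .
qed

lemma measurable_coeff_vec_node_poly: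
  assumes X: "X \<in> N \<rightarrow>\<^sub>M node_space k" and T: "T \<in> N \<rightarrow>\<^sub>M lborel_vec m"
  shows "(\<lambda>w. coeff_vec n (node_poly k (X w) * vec_poly m (T w))) \<in> N \<rightarrow>\<^sub>M lborel_vec n"
proof -
  have "(\<lambda>w. coeff (node_poly j (X w) * vec_poly m (T w)) i) \<in> borel_measurable N" if "j \<le> k" for i j
    using that
  proof (induction j arbitrary: i)
    case 0
    then show ?case
      using measurable_lborel_vec_component[OF T, of i] by (cases "i \<le> m") (simp_all add: node_poly_def coeff_vec_poly)
  next
    case (Suc j)
    have [measurable]: "(\<lambda>w. X w (Suc j)) \<in> borel_measurable N"
      using Suc.prems by (intro measurable_node_component[OF X]) auto
    have [measurable]: "(\<lambda>w. coeff (node_poly j (X w) * vec_poly m (T w)) i) \<in> borel_measurable N" for i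
      using Suc by simp
    show ?case
      unfolding node_poly_Suc mult.assoc coeff_linear_times by (cases i) simp_all
  qed
  then show ?thesis unfolding coeff_vec_def by (intro measurable_restrict) simp
qed

text \<open>Evaluating the old quotient, a multiple of the linear factor at \<open>y\<close>, at the
  earlier nodes yields exactly the new Vandermonde factors, while the area formula supplies the
  value of \<open>q\<close> at \<open>y\<close>. If \<open>y\<close> repeats a node, both sides
  vanish.\<close>

lemma root_weight_upd:
  "(\<Prod>i\<in>{1..k}. if y = x i then 0 else 1) * ennreal (root_weight k x ([:-y, 1:] * q)) * ennreal \<bar>poly q y\<bar>
    = ennreal (root_weight (Suc k) (x(Suc k := y)) q)"
proof -
  let ?x = "x(Suc k := y)"
  have "(\<Prod>i\<in>{1..Suc k}. \<Prod>j\<in>{i<..Suc k}. \<bar>?x i - ?x j\<bar>) = (\<Prod>i\<in>{1..k}. (\<Prod>j\<in>{i<..k}. \<bar>x i - x j\<bar>) * \<bar>x i - y\<bar>)"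
  proof -
    have "(\<Prod>j\<in>{i<..Suc k}. \<bar>?x i - ?x j\<bar>) = (\<Prod>j\<in>{i<..k}. \<bar>x i - x j\<bar>) * \<bar>x i - y\<bar>" if "i \<in> {1..k}" for i
    proof -
      have "{i<..Suc k} = insert (Suc k) {i<..k}" using that by auto
      moreover have "(\<Prod>j\<in>{i<..k}. \<bar>?x i - ?x j\<bar>) = (\<Prod>j\<in>{i<..k}. \<bar>x i - x j\<bar>)"
        using that by (intro prod.cong) auto
      ultimately show ?thesis using that by (simp add: mult.commute)
    qed
    then show ?thesis by (simp add: atLeastAtMost_insert_Suc)
  qed
  moreover have "(\<Prod>i\<in>{1..Suc k}. \<bar>poly q (?x i)\<bar>) = (\<Prod>i\<in>{1..k}. \<bar>poly q (x i)\<bar>) * \<bar>poly q y\<bar>"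
  proof -
    have "(\<Prod>i\<in>{1..k}. \<bar>poly q (?x i)\<bar>) = (\<Prod>i\<in>{1..k}. \<bar>poly q (x i)\<bar>)" by (rule prod.cong) auto
    then show ?thesis by (simp add: atLeastAtMost_insert_Suc mult.commute)
  qed
  moreover have "(\<Prod>i\<in>{1..k}. \<bar>poly ([:-y, 1:] * q) (x i)\<bar>) = (\<Prod>i\<in>{1..k}. \<bar>x i - y\<bar>) * (\<Prod>i\<in>{1..k}. \<bar>poly q (x i)\<bar>)"
  proof -
    have "poly ([:-y, 1:] * q) z = (z - y) * poly q z" for z by (simp add: algebra_simps)
    then show ?thesis by (simp only: abs_mult prod.distrib)
  qed
  ultimately have eq: "root_weight (Suc k) ?x q = root_weight k x ([:-y, 1:] * q) * \<bar>poly q y\<bar>"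
    by (simp only: root_weight_def prod.distrib mult_ac)
  show ?thesis
  proof (cases "\<exists>i\<in>{1..k}. y = x i")
    case True
    then obtain i where i: "i \<in> {1..k}" "y = x i" by blast
    then have "(\<Prod>i\<in>{1..k}. \<bar>poly ([:-y, 1:] * q) (x i)\<bar>) = 0"
      by (intro prod_zero bexI[of _ i]) auto
    then have "root_weight k x ([:-y, 1:] * q) = 0" by (simp only: root_weight_def mult_zero_right)
    then show ?thesis unfolding eq by simp
  next
    case False
    then have "(\<Prod>i\<in>{1..k}. if y = x i then 0 else 1 :: ennreal) = 1" by (intro prod.neutral) auto
    then show ?thesis unfolding eq
      by (simp add: ennreal_mult'' del: mult_pCons_left)
  qed
qed

text \<open>The product has only nodes as additional roots, and the separation factor kills those. A
  further distinct root can therefore be sought in the quotient.\<close>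

lemma sum_real_roots_node_poly_times:
  fixes F :: "real \<Rightarrow> ennreal"
  shows "(\<Sum>y\<in>real_roots (node_poly k x * q). (\<Prod>i\<in>{1..k}. if y = x i then 0 else 1) * F y) =
    (\<Sum>y\<in>real_roots q. (\<Prod>i\<in>{1..k}. if y = x i then 0 else 1) * F y)"
proof (rule sum.mono_neutral_right)
  show "real_roots q \<subseteq> real_roots (node_poly k x * q)"
    by (auto simp: real_roots_def node_poly_ne_0)
  show "\<forall>y\<in>real_roots (node_poly k x * q) - real_roots q. (\<Prod>i\<in>{1..k}. if y = x i then 0 else 1) * F y = 0"
  proof
    fix y assume "y \<in> real_roots (node_poly k x * q) - real_roots q"
    then have "poly (node_poly k x) y = 0" by (auto simp: real_roots_def split: if_splits)
    then have "(\<Prod>i\<in>{1..k}. if y = x i then 0 else 1 :: ennreal) = 0"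
      by (intro prod_zero) (auto simp: poly_node_poly)
    then show "(\<Prod>i\<in>{1..k}. if y = x i then 0 else 1) * F y = 0" by simp
  qed
qed simp

lemma borel_measurable_root_weight:
  assumes X: "X \<in> N \<rightarrow>\<^sub>M node_space k" and T: "T \<in> N \<rightarrow>\<^sub>M lborel_vec m"
  shows "(\<lambda>w. root_weight k (X w) (vec_poly m (T w))) \<in> borel_measurable N"
proof -
  have "(\<lambda>w. \<bar>X w i - X w j\<bar>) \<in> borel_measurable N" if "i \<in> {1..k}" "j \<in> {i<..k}" for i j
  proof -
    have "j \<in> {1..k}" using that by auto
    note [measurable] = measurable_node_component[OF X that(1)] measurable_node_component[OF X this]
    show ?thesis by measurable
  qed
  moreover have "(\<lambda>w. \<bar>poly (vec_poly m (T w)) (X w i)\<bar>) \<in> borel_measurable N" if "i \<in> {1..k}" for i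
  proof -
    note [measurable] = T measurable_node_component[OF X that]
    show ?thesis by measurable
  qed
  ultimately show ?thesis unfolding root_weight_def
    by (intro borel_measurable_times borel_measurable_prod)
qed

text \<open>The total \<open>k + m\<close> stays fixed while one unit moves from the quotient to the
  nodes. The sum over the last root is absorbed into the integrand of the induction hypothesis; it
  then reappears as a sum over roots of the quotient, to which the formula for one root
  applies.\<close>

lemma nn_integral_sum_root_tuples:
  assumes "(\<lambda>(a, x). H a x) \<in> borel_measurable (lborel_vec (k + m) \<Otimes>\<^sub>M node_space k)"
  shows "(\<integral>\<^sup>+a. (\<Sum>x\<in>root_tuples k (vec_poly (k + m) a). H a x) \<partial>lborel_vec (k + m)) =
    (\<integral>\<^sup>+x. \<integral>\<^sup>+t. H (coeff_vec (k + m) (node_poly k x * vec_poly m t)) x * ennreal (root_weight k x (vec_poly m t))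
      \<partial>lborel_vec m \<partial>node_space k)"
  using assms
proof (induction k arbitrary: m H)
  case 0
  have "(\<integral>\<^sup>+x. \<integral>\<^sup>+t. H (coeff_vec (0 + m) (node_poly 0 x * vec_poly m t)) x * ennreal (root_weight 0 x (vec_poly m t))
      \<partial>lborel_vec m \<partial>node_space 0) = (\<integral>\<^sup>+t. H (coeff_vec m (vec_poly m t)) (\<lambda>_. undefined) \<partial>lborel_vec m)"
    by (simp add: node_poly_def root_weight_def PiM_empty nn_integral_count_space_finite)
  also have "\<dots> = (\<integral>\<^sup>+t. H t (\<lambda>_. undefined) \<partial>lborel_vec m)"
    by (intro nn_integral_cong) (simp add: coeff_vec_vec_poly)
  finally show ?case by (simp add: root_tuples_0)
next
  case (Suc k)
  define sep where "sep x y = (\<Prod>i\<in>{1..k}. if y = x i then 0 else 1 :: ennreal)" for x :: "nat \<Rightarrow> real" and y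
  let ?n = "Suc k + m"
  have n: "k + Suc m = ?n" by simp
  have Hm: "(\<lambda>w. H (f w) (g w)) \<in> borel_measurable N"
    if "f \<in> N \<rightarrow>\<^sub>M lborel_vec ?n" "g \<in> N \<rightarrow>\<^sub>M node_space (Suc k)" for f g and N :: "'b measure"
  proof -
    have "(\<lambda>w. (f w, g w)) \<in> N \<rightarrow>\<^sub>M lborel_vec ?n \<Otimes>\<^sub>M node_space (Suc k)" using that by simp
    from measurable_compose[OF this Suc.prems] show ?thesis by simp
  qed
  have sep_m: "(\<lambda>w. sep (f w) (g w)) \<in> borel_measurable N"
    if "f \<in> N \<rightarrow>\<^sub>M node_space k" "g \<in> borel_measurable N" for f g and N :: "'b measure"
    unfolding sep_def using that by (rule borel_measurable_avoids_nodes)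
  define H' where "H' a x = (\<Sum>y\<in>real_roots (vec_poly ?n a). sep x y * H a (x(Suc k := y)))" for a x
  have H': "(\<lambda>(a, x). H' a x) \<in> borel_measurable (lborel_vec (k + Suc m) \<Otimes>\<^sub>M node_space k)"
    unfolding H'_def case_prod_beta n
  proof (rule borel_measurable_sum_real_roots)
    show "(\<lambda>(w, y). sep (snd w) y * H (fst w) ((snd w)(Suc k := y))) \<in>
        borel_measurable ((lborel_vec ?n \<Otimes>\<^sub>M node_space k) \<Otimes>\<^sub>M borel)"
      unfolding case_prod_beta
      by (intro borel_measurable_times_ennreal Hm sep_m measurable_node_upd) measurable
  qed measurable
  define J where "J x t y = sep x y * H (coeff_vec ?n (node_poly k x * vec_poly (Suc m) t)) (x(Suc k := y))
      * ennreal (root_weight k x (vec_poly (Suc m) t))" for x t y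
  have "(\<integral>\<^sup>+a. (\<Sum>x\<in>root_tuples (Suc k) (vec_poly ?n a). H a x) \<partial>lborel_vec ?n) =
      (\<integral>\<^sup>+a. (\<Sum>x\<in>root_tuples k (vec_poly (k + Suc m) a). H' a x) \<partial>lborel_vec (k + Suc m))"
    by (simp add: sum_root_tuples_Suc H'_def sep_def)
  also have "\<dots> = (\<integral>\<^sup>+x. \<integral>\<^sup>+t. H' (coeff_vec (k + Suc m) (node_poly k x * vec_poly (Suc m) t)) x
      * ennreal (root_weight k x (vec_poly (Suc m) t)) \<partial>lborel_vec (Suc m) \<partial>node_space k)"
    by (rule Suc.IH[OF H'])
  also have "\<dots> = (\<integral>\<^sup>+x. \<integral>\<^sup>+t. (\<Sum>y\<in>real_roots (vec_poly (Suc m) t). J x t y) \<partial>lborel_vec (Suc m) \<partial>node_space k)"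
  proof (intro nn_integral_cong)
    fix x t
    have "degree (node_poly k x * vec_poly (Suc m) t) \<le> ?n"
      using degree_mult_le[of "node_poly k x" "vec_poly (Suc m) t"] degree_vec_poly_le[of "Suc m" t]
      by (simp add: degree_node_poly)
    then show "H' (coeff_vec (k + Suc m) (node_poly k x * vec_poly (Suc m) t)) x * ennreal (root_weight k x (vec_poly (Suc m) t))
        = (\<Sum>y\<in>real_roots (vec_poly (Suc m) t). J x t y)"
      unfolding H'_def n J_def sep_def
      by (simp only: vec_poly_coeff_vec sum_real_roots_node_poly_times sum_distrib_right)
  qed
  also have "\<dots> = (\<integral>\<^sup>+x. \<integral>\<^sup>+y. \<integral>\<^sup>+s. J x (coeff_vec (Suc m) ([:-y, 1:] * vec_poly m s)) y * ennreal \<bar>poly (vec_poly m s) y\<bar>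
      \<partial>lborel_vec m \<partial>lborel \<partial>node_space k)"
  proof (intro nn_integral_cong nn_integral_sum_real_roots)
    fix x assume x: "x \<in> space (node_space k)"
    then show "(\<lambda>(t, y). J x t y) \<in> borel_measurable (lborel_vec (Suc m) \<Otimes>\<^sub>M borel)"
      unfolding J_def case_prod_beta
      by (intro borel_measurable_times_ennreal Hm sep_m measurable_node_upd measurable_coeff_vec_node_poly
        measurable_compose[OF borel_measurable_root_weight measurable_ennreal] measurable_const) measurable
  qed
  also have "\<dots> = (\<integral>\<^sup>+x. \<integral>\<^sup>+y. \<integral>\<^sup>+s. H (coeff_vec ?n (node_poly (Suc k) (x(Suc k := y)) * vec_poly m s)) (x(Suc k := y))
      * ennreal (root_weight (Suc k) (x(Suc k := y)) (vec_poly m s)) \<partial>lborel_vec m \<partial>lborel \<partial>node_space k)"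
  proof (intro nn_integral_cong)
    fix x y s
    have "degree ([:-y, 1:] * vec_poly m s) \<le> Suc m"
      using degree_mult_le[of "[:-y, 1:]" "vec_poly m s"] degree_vec_poly_le[of m s] by simp
    then have v: "vec_poly (Suc m) (coeff_vec (Suc m) ([:-y, 1:] * vec_poly m s)) = [:-y, 1:] * vec_poly m s"
      by (rule vec_poly_coeff_vec)
    show "J x (coeff_vec (Suc m) ([:-y, 1:] * vec_poly m s)) y * ennreal \<bar>poly (vec_poly m s) y\<bar> =
        H (coeff_vec ?n (node_poly (Suc k) (x(Suc k := y)) * vec_poly m s)) (x(Suc k := y))
        * ennreal (root_weight (Suc k) (x(Suc k := y)) (vec_poly m s))"
      unfolding J_def v node_poly_upd root_weight_upd[symmetric] sep_def by (simp only: mult_ac)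
  qed
  also have "\<dots> = (\<integral>\<^sup>+x. \<integral>\<^sup>+t. H (coeff_vec ?n (node_poly (Suc k) x * vec_poly m t)) x
      * ennreal (root_weight (Suc k) x (vec_poly m t)) \<partial>lborel_vec m \<partial>node_space (Suc k))"
  proof -
    interpret V: finite_product_sigma_finite "\<lambda>_::nat. lborel :: real measure" "{..m}" by standard simp
    have "(\<lambda>(x, t). H (coeff_vec ?n (node_poly (Suc k) x * vec_poly m t)) x
        * ennreal (root_weight (Suc k) x (vec_poly m t))) \<in> borel_measurable (node_space (Suc k) \<Otimes>\<^sub>M lborel_vec m)"
      unfolding case_prod_beta
      by (intro borel_measurable_times_ennreal Hm measurable_coeff_vec_node_poly
        measurable_compose[OF borel_measurable_root_weight measurable_ennreal]) measurable
    from V.borel_measurable_nn_integral[OF this]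
    show ?thesis unfolding atLeastAtMost_insert_Suc
      by (intro lborel_product.product_nn_integral_insert[symmetric]) simp_all
  qed
  finally show ?case .
qed

section \<open>Orthonormal expansions and joint densities\<close>

lemma esym_eq_0: "int k < d \<Longrightarrow> esym k x d = 0"
proof -
  assume "int k < d"
  have "card S \<noteq> nat d" if "S \<subseteq> {1..k}" for S
    using card_mono[OF _ that] \<open>int k < d\<close> by auto
  then show ?thesis by (auto simp: esym_def intro!: sum.neutral)
qed

text \<open>Vieta: in the expanded product, the set \<open>S\<close> of factors that contribute
  \<open>- x i\<close> produces a monomial of degree \<open>k - card S\<close>.\<close>

lemma coeff_node_poly:
  "coeff (node_poly k x) r = (if r \<le> k then (-1) ^ (k - r) * esym k x (int (k - r)) else 0)"
proof -
  have "node_poly k x = (\<Prod>i\<in>{1..k}. monom 1 1 - [:x i:])"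
    unfolding node_poly_def by (rule prod.cong) (auto simp: monom_altdef)
  also have "\<dots> = (\<Sum>S\<in>Pow {1..k}. (-1) ^ card S * (\<Prod>i\<in>S. [:x i:]) * (\<Prod>i\<in>{1..k} - S. monom 1 1))"
    by (rule prod_diff_conv_sum) simp
  also have "\<dots> = (\<Sum>S\<in>Pow {1..k}. monom ((-1) ^ card S * (\<Prod>i\<in>S. x i)) (k - card S))"
  proof (rule sum.cong)
    fix S assume "S \<in> Pow {1..k}"
    then have "card ({1..k} - S) = k - card S" by (subst card_Diff_subset) (auto intro: finite_subset)
    moreover have "(\<Prod>i\<in>S. [:x i:]) = [:\<Prod>i\<in>S. x i:]"
      by (induction S rule: infinite_finite_induct) (auto simp: one_pCons)
    moreover have "(-1 :: real poly) ^ j = [:(-1) ^ j:]" for j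
      by (induction j) (auto simp: one_pCons)
    ultimately show "(-1) ^ card S * (\<Prod>i\<in>S. [:x i:]) * (\<Prod>i\<in>{1..k} - S. monom 1 1)
        = monom ((-1) ^ card S * (\<Prod>i\<in>S. x i)) (k - card S)"
      by (simp add: monom_power smult_monom)
  qed simp
  finally have "coeff (node_poly k x) r =
      (\<Sum>S\<in>Pow {1..k}. if k - card S = r then (-1) ^ card S * (\<Prod>i\<in>S. x i) else 0)"
    by (simp add: coeff_sum)
  also have "\<dots> = (if r \<le> k then (-1) ^ (k - r) * esym k x (int (k - r)) else 0)"
  proof (cases "r \<le> k")
    case True
    have "(\<Sum>S\<in>Pow {1..k}. if k - card S = r then (-1) ^ card S * (\<Prod>i\<in>S. x i) else 0) =
        (\<Sum>S\<in>{S. S \<subseteq> {1..k} \<and> card S = k - r}. (-1) ^ (k - r) * (\<Prod>i\<in>S. x i))"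
    proof (rule sum.mono_neutral_cong_right)
      have card: "card S \<le> k" if "S \<in> Pow {1..k}" for S
        using card_mono[of "{1..k}" S] that by auto
      show "\<forall>S\<in>Pow {1..k} - {S. S \<subseteq> {1..k} \<and> card S = k - r}.
          (if k - card S = r then (-1) ^ card S * (\<Prod>i\<in>S. x i) else 0) = 0"
        using card by auto
      show "(if k - card S = r then (-1) ^ card S * (\<Prod>i\<in>S. x i) else 0) = (-1) ^ (k - r) * (\<Prod>i\<in>S. x i)"
        if "S \<in> {S. S \<subseteq> {1..k} \<and> card S = k - r}" for S
        using that True by auto
    qed auto
    also have "\<dots> = (-1) ^ (k - r) * esym k x (int (k - r))"
      by (simp add: esym_def sum_distrib_left)
    finally show ?thesis using True by simp
  next
    case False
    then show ?thesis by (auto intro!: sum.neutral)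
  qed
  finally show ?thesis .
qed

text \<open>The index \<open>int k - int i + int j\<close> can leave the range from 0 to
  \<open>k\<close> on either side. There \<open>esym\<close> vanishes, just as the corresponding
  coefficient of \<open>node_poly\<close> does; hence integers rather than truncated
  subtraction.\<close>

lemma coeff_node_poly_times_vec_poly:
  "coeff (node_poly k x * vec_poly m t) i =
    (\<Sum>j\<le>m. (-1) powi (int k - int i + int j) * esym k x (int k - int i + int j) * t j)"
proof -
  have "coeff (node_poly k x * vec_poly m t) i = (\<Sum>j\<le>m. coeff (monom (t j) j * node_poly k x) i)"
    by (simp add: vec_poly_def sum_distrib_left coeff_sum mult.commute)
  also have "\<dots> = (\<Sum>j\<le>m. (-1) powi (int k - int i + int j) * esym k x (int k - int i + int j) * t j)"
  proof (rule sum.cong)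
    fix j
    consider "i < j" | "j \<le> i" "k < i - j" | "j \<le> i" "i - j \<le> k" by linarith
    then show "coeff (monom (t j) j * node_poly k x) i =
        (-1) powi (int k - int i + int j) * esym k x (int k - int i + int j) * t j"
    proof cases
      case 1
      then show ?thesis by (simp add: coeff_monom_mult esym_eq_0)
    next
      case 2
      then show ?thesis by (simp add: coeff_monom_mult coeff_node_poly esym_def)
    next
      case 3
      then have d: "int k - int i + int j = int (k - (i - j))" by simp
      show ?thesis unfolding d power_int_of_nat using 3 by (simp add: coeff_monom_mult coeff_node_poly mult.commute[of "t j"])
    qed
  qed simp
  finally show ?thesis .
qed

section \<open>Change of basis from monomials to orthonormal polynomials\<close>

lemma integrable_poly:
  fixes mu :: "real measure" and q :: "real poly"
  assumes "\<And>i. integrable mu (\<lambda>x. x ^ i)"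
  shows "integrable mu (poly q)"
  unfolding poly_altdef[abs_def] by (intro Bochner_Integration.integrable_sum integrable_mult_right assms)

lemma integrable_poly_mult:
  fixes mu :: "real measure" and q r :: "real poly"
  assumes "\<And>i. integrable mu (\<lambda>x. x ^ i)"
  shows "integrable mu (\<lambda>x. poly q x * poly r x)"
proof -
  have "(\<lambda>x. poly q x * poly r x) = poly (q * r)" by auto
  then show ?thesis using integrable_poly[OF assms] by simp
qed

text \<open>Subtracting a multiple of \<open>p n\<close> removes the leading term. The top
  coefficient is recorded because it becomes the diagonal entry of the change of basis.\<close>

lemma orthonormal_expansion_exists:
  fixes p :: "nat \<Rightarrow> real poly"
  assumes deg: "\<And>i. degree (p i) = i" and lead: "\<And>i. lead_coeff (p i) > 0" and "degree q \<le> n"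
  shows "\<exists>d. q = (\<Sum>l\<le>n. smult (d l) (p l)) \<and> d n = coeff q n / lead_coeff (p n)"
  using assms(3)
proof (induction n arbitrary: q)
  case 0
  obtain c where "p 0 = [:c:]" using degree_eq_zeroE[OF deg[of 0]] .
  moreover obtain e where "q = [:e:]" using 0 by (auto elim: degree_eq_zeroE)
  ultimately show ?case using lead[of 0] by (intro exI[of _ "\<lambda>_. e / c"]) simp
next
  case (Suc n)
  define d where "d = coeff q (Suc n) / lead_coeff (p (Suc n))"
  have "degree (q - smult d (p (Suc n))) \<le> n"
  proof (rule degree_le, intro allI impI)
    fix i assume "n < i"
    then consider "i = Suc n" | "Suc n < i" by linarith
    then show "coeff (q - smult d (p (Suc n))) i = 0"
    proof cases
      case 1
      then show ?thesis using lead[of "Suc n"] deg[of "Suc n"] by (simp add: d_def)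
    next
      case 2
      then show ?thesis using Suc.prems deg[of "Suc n"] by (simp add: coeff_eq_0)
    qed
  qed
  from Suc.IH[OF this] obtain e where e: "q - smult d (p (Suc n)) = (\<Sum>l\<le>n. smult (e l) (p l))" by blast
  show ?case
  proof (intro exI conjI)
    have "(\<Sum>l\<le>n. smult ((e(Suc n := d)) l) (p l)) = (\<Sum>l\<le>n. smult (e l) (p l))" by (rule sum.cong) auto
    then show "q = (\<Sum>l\<le>Suc n. smult ((e(Suc n := d)) l) (p l))" using e by (simp add: algebra_simps)
    show "(e(Suc n := d)) (Suc n) = coeff q (Suc n) / lead_coeff (p (Suc n))" by (simp add: d_def)
  qed
qed

context
  fixes mu :: "real measure" and p :: "nat \<Rightarrow> real poly"
  assumes moments: "\<And>i. integrable mu (\<lambda>x. x ^ i)"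
    and deg: "\<And>i. degree (p i) = i"
    and lead_pos: "\<And>i. lead_coeff (p i) > 0"
    and orthonormal: "\<And>i j. (\<integral>x. poly (p i) x * poly (p j) x \<partial>mu) = (if i = j then 1 else 0)"
begin

lemma integral_sum_orthonormal:
  "(\<integral>x. poly (\<Sum>j\<le>n. smult (d j) (p j)) x * poly (p l) x \<partial>mu) = (if l \<le> n then d l else 0)"
proof -
  have int: "integrable mu (\<lambda>x. poly (p j) x * poly (p l) x)" for j
    by (rule integrable_poly_mult[OF moments])
  have "(\<integral>x. poly (\<Sum>j\<le>n. smult (d j) (p j)) x * poly (p l) x \<partial>mu) =
      (\<integral>x. (\<Sum>j\<le>n. d j * (poly (p j) x * poly (p l) x)) \<partial>mu)"
    by (simp add: poly_sum sum_distrib_right mult.assoc)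
  also have "\<dots> = (\<Sum>j\<le>n. d j * (if j = l then 1 else 0))"
    using int by (subst Bochner_Integration.integral_sum) (auto simp: orthonormal)
  also have "\<dots> = (if l \<le> n then d l else 0)" by (simp add: if_distrib cong: if_cong)
  finally show ?thesis .
qed

lemma orthonormal_expansion:
  assumes "degree q \<le> n"
  shows "(\<Sum>l\<le>n. smult (\<integral>x. poly q x * poly (p l) x \<partial>mu) (p l)) = q"
proof -
  obtain d where d: "q = (\<Sum>l\<le>n. smult (d l) (p l))"
    using orthonormal_expansion_exists[OF deg lead_pos assms] by blast
  have "(\<integral>x. poly q x * poly (p l) x \<partial>mu) = d l" if "l \<le> n" for l
    using integral_sum_orthonormal[of d n l] that unfolding d by simp
  then show ?thesis by (subst (2) d) (auto intro!: sum.cong)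
qed

text \<open>The monomial of degree \<open>i\<close> is a combination of \<open>p 0\<close> up to
  \<open>p i\<close>, and its coefficient at \<open>p i\<close> is the inverse of the leading
  coefficient.\<close>

lemma moment_orthonormal_triangular: "i < l \<Longrightarrow> (\<integral>y. y ^ i * poly (p l) y \<partial>mu) = 0"
  and moment_orthonormal_diag: "(\<integral>y. y ^ i * poly (p i) y \<partial>mu) = inverse (lead_coeff (p i))"
proof -
  obtain d where d: "monom 1 i = (\<Sum>l\<le>i. smult (d l) (p l))" "d i = coeff (monom 1 i) i / lead_coeff (p i)"
    using orthonormal_expansion_exists[OF deg lead_pos degree_monom_le] by blast
  have *: "(\<integral>y. y ^ i * poly (p l) y \<partial>mu) = (if l \<le> i then d l else 0)" for l
    using integral_sum_orthonormal[of d i l] unfolding d(1)[symmetric] by (simp add: poly_monom)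
  show "(\<integral>y. y ^ i * poly (p l) y \<partial>mu) = 0" if "i < l" using * that by simp
  show "(\<integral>y. y ^ i * poly (p i) y \<partial>mu) = inverse (lead_coeff (p i))"
    using * d(2) by (simp add: inverse_eq_divide)
qed

text \<open>The vanishing moments below the diagonal make the triangular map compute full inner
  products with \<open>p l\<close>. It thus sends monomial coefficients to coefficients in the
  orthonormal basis.\<close>

lemma sum_triangular_map_orthonormal:
  "(\<Sum>l\<le>n. smult (triangular_map (\<lambda>l i. \<integral>y. y ^ i * poly (p l) y \<partial>mu) n a l) (p l)) = vec_poly n a"
proof -
  have "triangular_map (\<lambda>l i. \<integral>y. y ^ i * poly (p l) y \<partial>mu) n a l = (\<integral>y. poly (vec_poly n a) y * poly (p l) y \<partial>mu)"
    if "l \<le> n" for l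
  proof -
    have int: "integrable mu (\<lambda>y. y ^ i * poly (p l) y)" for i
      using integrable_poly_mult[OF moments, of "monom 1 i" "p l"] by (simp add: poly_monom)
    have "(\<integral>y. poly (vec_poly n a) y * poly (p l) y \<partial>mu) = (\<integral>y. (\<Sum>i\<le>n. a i * (y ^ i * poly (p l) y)) \<partial>mu)"
      by (simp add: poly_vec_poly sum_distrib_right mult.assoc)
    also have "\<dots> = (\<Sum>i\<le>n. (\<integral>y. y ^ i * poly (p l) y \<partial>mu) * a i)"
      using int by (subst Bochner_Integration.integral_sum) (auto simp: mult.commute)
    also have "\<dots> = (\<Sum>i=l..n. (\<integral>y. y ^ i * poly (p l) y \<partial>mu) * a i)"
      by (rule sum.mono_neutral_right) (auto simp: moment_orthonormal_triangular)
    finally show ?thesis using that by (simp add: triangular_map_def)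
  qed
  then show ?thesis
    using orthonormal_expansion[OF degree_vec_poly_le[of n a]] by simp
qed

end

section \<open>Joint law of independent variables with densities\<close>

lemma nn_integral_indep_densities:
  fixes \<xi> :: "nat \<Rightarrow> 'a \<Rightarrow> real" and f :: "nat \<Rightarrow> real \<Rightarrow> ennreal"
  assumes M: "prob_space M" and indep: "prob_space.indep_vars M (\<lambda>_. borel) \<xi> {..n}"
    and dens: "\<And>i. i \<le> n \<Longrightarrow> distributed M lborel (\<xi> i) (f i)"
    and \<Phi>: "\<Phi> \<in> borel_measurable (lborel_vec n)"
  shows "(\<integral>\<^sup>+\<omega>. \<Phi> (\<lambda>i\<in>{..n}. \<xi> i \<omega>) \<partial>M) = (\<integral>\<^sup>+u. (\<Prod>l\<le>n. f l (u l)) * \<Phi> u \<partial>lborel_vec n)"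
proof -
  interpret prob_space M by (rule M)
  have \<xi>: "\<xi> i \<in> borel_measurable M" if "i \<le> n" for i
    using distributed_measurable[OF dens[OF that]] by simp
  have f: "f i \<in> borel_measurable lborel" if "i \<le> n" for i
    using distributed_borel_measurable[OF dens[OF that]] .
  have fu[measurable]: "(\<lambda>u. f l (u l)) \<in> borel_measurable (lborel_vec n)" if "l \<le> n" for l
  proof -
    have "(\<lambda>u. u l) \<in> lborel_vec n \<rightarrow>\<^sub>M lborel" using that by (intro measurable_component_singleton) simp
    from measurable_compose[OF this f[OF that]] show ?thesis .
  qed
  then have fm[measurable]: "(\<lambda>u. \<Prod>l\<le>n. f l (u l)) \<in> borel_measurable (lborel_vec n)"
    by (intro borel_measurable_prod_ennreal) auto
  \<comment> \<open>Every \<open>N i\<close> has to be a probability measure, also beyond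
    \<open>n\<close>, where \<open>\<xi> 0\<close> serves as a filler.\<close>
  define N where "N i = distr M borel (if i \<le> n then \<xi> i else \<xi> 0)" for i
  have N: "N i = density lborel (f i)" if "i \<le> n" for i
  proof -
    have "distr M borel (\<xi> i) = distr M lborel (\<xi> i)" by (rule distr_cong) auto
    then show ?thesis using distributed_distr_eq_density[OF dens[OF that]] that by (simp add: N_def)
  qed
  have "prob_space (N i)" for i
    unfolding N_def using \<xi> by (intro prob_space_distr) simp
  then interpret N: product_prob_space N by (rule product_prob_spaceI)
  have sets: "sets (PiM {..n} N) = sets (lborel_vec n)"
    by (intro sets_PiM_cong) (auto simp: N_def)
  have "density (lborel_vec n) (\<lambda>u. \<Prod>l\<le>n. f l (u l)) = PiM {..n} N"
  proof (rule N.PiM_eqI)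
    fix A :: "nat \<Rightarrow> real set" assume "\<And>i. i \<in> {..n} \<Longrightarrow> A i \<in> sets (N i)"
    then have A: "A i \<in> sets borel" if "i \<le> n" for i using that by (simp add: N_def)
    have "emeasure (density (lborel_vec n) (\<lambda>u. \<Prod>l\<le>n. f l (u l))) (Pi\<^sub>E {..n} A) =
        (\<integral>\<^sup>+u. (\<Prod>l\<le>n. f l (u l)) * indicator (Pi\<^sub>E {..n} A) u \<partial>lborel_vec n)"
      by (intro emeasure_density fm sets_PiM_I_finite) (use A in auto)
    also have "\<dots> = (\<integral>\<^sup>+u. (\<Prod>l\<le>n. f l (u l) * indicator (A l) (u l)) \<partial>lborel_vec n)"
    proof (rule nn_integral_cong)
      fix u assume "u \<in> space (lborel_vec n)"
      then have "u \<in> Pi\<^sub>E {..n} A \<longleftrightarrow> (\<forall>l\<le>n. u l \<in> A l)" by (auto simp: space_PiM PiE_iff)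
      then have "indicator (Pi\<^sub>E {..n} A) u = (\<Prod>l\<le>n. indicator (A l) (u l) :: ennreal)"
        by (auto simp: indicator_def intro!: prod_zero[symmetric])
      then show "(\<Prod>l\<le>n. f l (u l)) * indicator (Pi\<^sub>E {..n} A) u = (\<Prod>l\<le>n. f l (u l) * indicator (A l) (u l))"
        by (simp add: prod.distrib)
    qed
    also have "\<dots> = (\<Prod>l\<le>n. \<integral>\<^sup>+z. f l z * indicator (A l) z \<partial>lborel)"
      using f A by (intro lborel_product.product_nn_integral_prod) auto
    also have "\<dots> = (\<Prod>i\<in>{..n}. emeasure (N i) (A i))"
      using f A by (intro prod.cong) (auto simp: N emeasure_density)
    finally show "emeasure (density (lborel_vec n) (\<lambda>u. \<Prod>l\<le>n. f l (u l))) (Pi\<^sub>E {..n} A) =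
        (\<Prod>i\<in>{..n}. emeasure (N i) (A i))" .
  qed (simp_all add: sets)
  also have "\<dots> = PiM {..n} (\<lambda>i. distr M borel (\<xi> i))"
    by (rule PiM_cong) (auto simp: N_def)
  also have "\<dots> = distr M (PiM {..n} (\<lambda>_. borel)) (\<lambda>\<omega>. \<lambda>i\<in>{..n}. \<xi> i \<omega>)"
    using indep_vars_iff_distr_eq_PiM'[of "{..n}" \<xi> "\<lambda>_. borel"] \<xi> indep by simp
  finally have eq: "density (lborel_vec n) (\<lambda>u. \<Prod>l\<le>n. f l (u l)) =
      distr M (PiM {..n} (\<lambda>_. borel)) (\<lambda>\<omega>. \<lambda>i\<in>{..n}. \<xi> i \<omega>)" .
  have sets': "sets (PiM {..n} (\<lambda>_. borel)) = sets (lborel_vec n)" by (intro sets_PiM_cong) auto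
  have \<Phi>': "\<Phi> \<in> borel_measurable (PiM {..n} (\<lambda>_. borel))"
    using \<Phi> measurable_cong_sets[OF sets' refl] by blast
  have "(\<integral>\<^sup>+\<omega>. \<Phi> (\<lambda>i\<in>{..n}. \<xi> i \<omega>) \<partial>M) = (\<integral>\<^sup>+u. \<Phi> u \<partial>distr M (PiM {..n} (\<lambda>_. borel)) (\<lambda>\<omega>. \<lambda>i\<in>{..n}. \<xi> i \<omega>))"
    by (intro nn_integral_distr[symmetric] measurable_restrict \<xi>) (simp_all add: \<Phi>')
  also have "\<dots> = (\<integral>\<^sup>+u. (\<Prod>l\<le>n. f l (u l)) * \<Phi> u \<partial>lborel_vec n)"
    unfolding eq[symmetric] by (rule nn_integral_density) (use fm \<Phi> in auto)
  finally show ?thesis .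
qed

section \<open>The correlation function\<close>

text \<open>For the zero polynomial this is the set of all zero tuples. Being infinite, it gives the
  sum the default value 0, in agreement with the empty \<open>root_tuples\<close>. The translates of
  one injective tuple suffice.\<close>

lemma infinite_inj_tuples:
  fixes k :: nat
  assumes "1 \<le> k"
  shows "infinite {x \<in> PiE {1..k} (\<lambda>_. UNIV :: real set). inj_on x {1..k}}"
proof -
  define h where "h c = (\<lambda>i\<in>{1..k}. c + real i)" for c
  have "inj h"
  proof
    fix c d assume "h c = h d"
    then have "h c 1 = h d 1" by simp
    then show "c = d" using assms by (simp add: h_def)
  qed
  then have "infinite (range h)" by (metis finite_imageD infinite_UNIV_char_0)
  moreover have "range h \<subseteq> {x \<in> PiE {1..k} (\<lambda>_. UNIV). inj_on x {1..k}}"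
    by (auto simp: h_def inj_on_def)
  ultimately show ?thesis by (rule infinite_super[rotated])
qed

lemma sum_zero_tuples_poly:
  assumes "1 \<le> k"
  shows "(\<Sum>x\<in>zero_tuples k (poly q). G x) = (\<Sum>x\<in>root_tuples k q. G x)"
proof (cases "q = 0")
  case True
  have "zero_tuples k (poly q) = {x \<in> PiE {1..k} (\<lambda>_. UNIV). inj_on x {1..k}}"
    using True by (auto simp: zero_tuples_def)
  moreover have "root_tuples k q = {}" using True assms by (auto simp: root_tuples_def real_roots_def)
  ultimately show ?thesis using infinite_inj_tuples[OF assms] by simp
next
  case False
  then have "zero_tuples k (poly q) = root_tuples k q" by (auto simp: zero_tuples_def root_tuples_def real_roots_def)
  then show ?thesis by simp
qed

text \<open>Continuity refers to the topology on all functions, whose Borel sets form the product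
  sigma-algebra because the index type is countable. The product over \<open>I\<close> embeds there
  with coordinates outside \<open>I\<close> frozen at \<open>undefined\<close>.\<close>

lemma borel_measurable_continuous_on_PiE:
  fixes G :: "(nat \<Rightarrow> real) \<Rightarrow> real"
  assumes "continuous_on (PiE I (\<lambda>_. UNIV)) G"
  shows "G \<in> borel_measurable (PiM I (\<lambda>_. lborel))"
proof -
  have "(\<lambda>x. x) \<in> PiM I (\<lambda>_. lborel :: real measure) \<rightarrow>\<^sub>M PiM UNIV (\<lambda>_. borel)"
  proof (rule measurable_PiM_single')
    fix i
    show "(\<lambda>x. x i) \<in> PiM I (\<lambda>_. lborel :: real measure) \<rightarrow>\<^sub>M borel"
    proof (cases "i \<in> I")
      case True
      then show ?thesis using measurable_component_singleton[of i I "\<lambda>_. lborel :: real measure"] by simp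
    next
      case False
      then have "x i = undefined" if "x \<in> space (PiM I (\<lambda>_. lborel :: real measure))" for x
        using that by (auto simp: space_PiM PiE_def extensional_def)
      then show ?thesis by (subst measurable_cong[where g="\<lambda>_. undefined"]) simp_all
    qed
  qed auto
  then have "(\<lambda>x. x) \<in> PiM I (\<lambda>_. lborel :: real measure) \<rightarrow>\<^sub>M borel"
    using measurable_cong_sets[OF refl sets_PiM_equal_borel] by blast
  then have "(\<lambda>x. x) \<in> PiM I (\<lambda>_. lborel :: real measure) \<rightarrow>\<^sub>M restrict_space borel (PiE I (\<lambda>_. UNIV))"
    by (intro measurable_restrict_space2) (auto simp: space_PiM)
  from measurable_compose[OF this borel_measurable_continuous_on_restrict[OF assms]] show ?thesis .
qed

lemma bounded_continuous_compact_support: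
  fixes G :: "(nat \<Rightarrow> real) \<Rightarrow> real"
  assumes cont: "continuous_on (PiE I (\<lambda>_. UNIV)) G"
    and supp: "\<forall>x\<in>PiE I (\<lambda>_. UNIV). (\<exists>i\<in>I. \<bar>x i\<bar> > B) \<longrightarrow> G x = 0"
  obtains C where "C \<ge> 0" "\<And>x. x \<in> PiE I (\<lambda>_. UNIV) \<Longrightarrow> \<bar>G x\<bar> \<le> C"
proof -
  let ?K = "PiE I (\<lambda>_. {-B..B})"
  \<comment> \<open>Singleton factors outside \<open>I\<close> present the box as a product of
    compact sets over all indices, so that it is compact in the function topology.\<close>
  have "?K = PiE UNIV (\<lambda>i. if i \<in> I then {-B..B} else {undefined})"
    by (auto simp: PiE_iff extensional_def split: if_splits)
  then have "compactin (product_topology (\<lambda>_. euclidean) UNIV) ?K"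
    by (auto simp: compactin_PiE)
  then have "compact ?K" by (simp add: euclidean_product_topology)
  moreover have "continuous_on ?K G" by (rule continuous_on_subset[OF cont]) (auto simp: PiE_iff)
  ultimately have "bounded (G ` ?K)" by (intro compact_imp_bounded compact_continuous_image)
  then obtain C where C: "\<And>x. x \<in> ?K \<Longrightarrow> \<bar>G x\<bar> \<le> C" by (auto simp: bounded_iff)
  have "\<bar>G x\<bar> \<le> max C 0" if x: "x \<in> PiE I (\<lambda>_. UNIV)" for x
  proof (cases "x \<in> ?K")
    case True
    then show ?thesis using C[of x] by simp
  next
    case False
    then obtain i where "i \<in> I" "x i \<notin> {-B..B}" using x by (auto simp: PiE_iff)
    then have "i \<in> I" "B < \<bar>x i\<bar>" by auto
    then show ?thesis using supp x by auto
  qed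
  then show ?thesis by (intro that[of "max C 0"]) auto
qed

theorem theorem12p2:
  fixes mu :: "real measure" and p :: "nat \<Rightarrow> real poly"
    and M :: "'a measure" and \<xi> :: "nat \<Rightarrow> 'a \<Rightarrow> real" and f :: "nat \<Rightarrow> real \<Rightarrow> real"
    and k n :: nat
    and G :: "(nat \<Rightarrow> real) \<Rightarrow> real"
  assumes mu_sets: "sets mu = sets borel"
    and moments: "\<And>i. integrable mu (\<lambda>x. x ^ i)"
    and deg: "\<And>i. degree (p i) = i"
    and lead_pos: "\<And>i. lead_coeff (p i) > 0"
    and orthonormal: "\<And>i j. (\<integral>x. poly (p i) x * poly (p j) x \<partial>mu) = (if i = j then 1 else 0)"
    and M_prob: "prob_space M"
    and indep: "prob_space.indep_vars M (\<lambda>_. borel) \<xi> {0..n}"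
    and dens: "\<And>i. i \<le> n \<Longrightarrow> distributed M lborel (\<xi> i) (\<lambda>x. ennreal (f i x))"
    and dens_nonneg: "\<And>i x. i \<le> n \<Longrightarrow> f i x \<ge> 0"
    and k_ge: "1 \<le> k" and k_le: "k \<le> n"
    and G_cont: "continuous_on (PiE {1..k} (\<lambda>_. UNIV)) G"
    and G_supp: "\<exists>B. \<forall>x\<in>PiE {1..k} (\<lambda>_. UNIV). (\<exists>i\<in>{1..k}. \<bar>x i\<bar> > B) \<longrightarrow> G x = 0"
  defines "R \<equiv> (\<lambda>x::nat \<Rightarrow> real.
      (\<Prod>m\<le>n. inverse (lead_coeff (p m))) *
      (\<Prod>i\<in>{1..k}. \<Prod>j\<in>{i<..k}. \<bar>x i - x j\<bar>) *
      (\<integral>t. (\<Prod>l\<le>n. f l (\<Sum>i=l..n.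
                (\<Sum>j\<le>n-k. (-1::real) powi (int k - int i + int j)
                              * esym k x (int k - int i + int j) * t j)
                * (\<integral>y. y ^ i * poly (p l) y \<partial>mu)))
           * (\<Prod>i\<in>{1..k}. \<bar>\<Sum>j\<le>n-k. t j * x i ^ j\<bar>)
        \<partial>(PiM {..n-k} (\<lambda>_. lborel))))"
  shows "integrable (PiM {1..k} (\<lambda>_. lborel)) (\<lambda>x. G x * R x) \<and>
    (\<integral>\<omega>. (\<Sum>x\<in>zero_tuples k (\<lambda>y. \<Sum>i\<le>n. \<xi> i \<omega> * poly (p i) y). G x) \<partial>M)
      = (\<integral>x. G x * R x \<partial>(PiM {1..k} (\<lambda>_. lborel)))"
proof -
  interpret prob_space M by (rule M_prob)
  define m where "m = n - k"
  have n: "n = k + m" using k_le by (simp add: m_def)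
  interpret V: finite_product_sigma_finite "\<lambda>_::nat. lborel :: real measure" "{..m}" by standard simp
  define C where "C = (\<lambda>l i. \<integral>y. y ^ i * poly (p l) y \<partial>mu)"
  define h where "h x = (\<Prod>m\<le>n. inverse (lead_coeff (p m))) * (\<Prod>i\<in>{1..k}. \<Prod>j\<in>{i<..k}. \<bar>x i - x j\<bar>)"
    for x :: "nat \<Rightarrow> real"
  define T where "T x t = triangular_map C n (coeff_vec n (node_poly k x * vec_poly m t))" for x t
  define r where "r x t = (\<Prod>l\<le>n. f l (T x t l)) * (\<Prod>i\<in>{1..k}. \<bar>poly (vec_poly m t) (x i)\<bar>)" for x t
  \<comment> \<open>Kept extended-valued: it may be infinite at some \<open>x\<close>.\<close>
  define rr where "rr x = (\<integral>\<^sup>+t. ennreal (r x t) \<partial>lborel_vec m)" for x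
  define P where "P \<omega> = (\<Sum>i\<le>n. smult (\<xi> i \<omega>) (p i))" for \<omega>
  have inv_nonneg: "(\<Prod>m\<le>n. inverse (lead_coeff (p m))) \<ge> 0"
    using lead_pos by (intro prod_nonneg) (simp add: less_imp_le)
  have h_nonneg: "h x \<ge> 0" for x
    unfolding h_def by (rule mult_nonneg_nonneg[OF inv_nonneg]) (simp add: prod_nonneg)
  have f_meas: "f l \<in> borel_measurable borel" if "l \<le> n" for l
    using distributed_real_measurable[OF _ dens[OF that]] dens_nonneg[OF that] by simp
  have \<xi>_meas[measurable]: "\<xi> i \<in> borel_measurable M" if "i \<le> n" for i
    using distributed_measurable[OF dens[OF that]] by simp
  have r_nonneg: "r x t \<ge> 0" for x t
    unfolding r_def by (intro mult_nonneg_nonneg prod_nonneg) (auto simp: dens_nonneg)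
  have T_meas: "(\<lambda>w. T (X w) (S w)) \<in> N \<rightarrow>\<^sub>M lborel_vec n"
    if "X \<in> N \<rightarrow>\<^sub>M node_space k" "S \<in> N \<rightarrow>\<^sub>M lborel_vec m" for X S and N :: "'b measure"
    unfolding T_def
    by (intro measurable_compose[OF measurable_coeff_vec_node_poly[OF that] measurable_triangular_map])
  have r_meas: "(\<lambda>w. r (X w) (S w)) \<in> borel_measurable N"
    if X: "X \<in> N \<rightarrow>\<^sub>M node_space k" and S: "S \<in> N \<rightarrow>\<^sub>M lborel_vec m" for X S and N :: "'b measure"
    unfolding r_def
  proof (intro borel_measurable_times borel_measurable_prod)
    show "(\<lambda>w. f l (T (X w) (S w) l)) \<in> borel_measurable N" if "l \<in> {..n}" for l
      using that by (intro measurable_compose[OF measurable_lborel_vec_component[OF T_meas[OF X S]] f_meas]) auto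
    show "(\<lambda>w. \<bar>poly (vec_poly m (S w)) (X w i)\<bar>) \<in> borel_measurable N" if "i \<in> {1..k}" for i
    proof -
      note [measurable] = S measurable_node_component[OF X that]
      show ?thesis by measurable
    qed
  qed
  have rr_meas: "rr \<in> borel_measurable (node_space k)"
  proof -
    have "(\<lambda>(x, t). ennreal (r x t)) \<in> borel_measurable (node_space k \<Otimes>\<^sub>M lborel_vec m)"
      unfolding case_prod_beta by (intro measurable_compose[OF r_meas measurable_ennreal]) measurable
    from V.borel_measurable_nn_integral[OF this] show ?thesis unfolding rr_def[abs_def] .
  qed
  have h_meas: "h \<in> borel_measurable (node_space k)"
    unfolding h_def[abs_def]
  proof (intro borel_measurable_times borel_measurable_prod borel_measurable_const)
    fix i j assume "i \<in> {1..k}" "j \<in> {i<..k}"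
    then have "i \<in> {1..k}" "j \<in> {1..k}" by auto
    note [measurable] = this[THEN measurable_node_component[OF measurable_ident_sets[OF refl]]]
    show "(\<lambda>x. \<bar>x i - x j\<bar>) \<in> borel_measurable (node_space k)" by measurable
  qed
  \<comment> \<open>\<open>enn2real\<close> maps \<infinity> to 0, the same default that the Bochner
    integral takes when the nonnegative integrand is not integrable.\<close>
  have R: "R x = h x * enn2real (rr x)" if x: "x \<in> space (node_space k)" for x
  proof -
    have "T x t l = (\<Sum>i=l..n. (\<Sum>j\<le>n-k. (-1::real) powi (int k - int i + int j)
          * esym k x (int k - int i + int j) * t j) * (\<integral>y. y ^ i * poly (p l) y \<partial>mu))" if "l \<le> n" for t l
      unfolding T_def triangular_map_def C_def m_def[symmetric] coeff_node_poly_times_vec_poly[symmetric]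
      using that by (auto simp: coeff_vec_def intro!: sum.cong)
    then have "(\<Prod>l\<le>n. f l (\<Sum>i=l..n. (\<Sum>j\<le>n-k. (-1::real) powi (int k - int i + int j)
          * esym k x (int k - int i + int j) * t j) * (\<integral>y. y ^ i * poly (p l) y \<partial>mu)))
        * (\<Prod>i\<in>{1..k}. \<bar>\<Sum>j\<le>n-k. t j * x i ^ j\<bar>) = r x t" for t
      unfolding r_def poly_vec_poly m_def[symmetric] by simp
    then have "R x = h x * (\<integral>t. r x t \<partial>lborel_vec m)"
      unfolding R_def h_def by (simp add: m_def)
    also have "(\<integral>t. r x t \<partial>lborel_vec m) = enn2real (rr x)"
      unfolding rr_def using r_meas[of "\<lambda>_. x" "lborel_vec m" "\<lambda>t. t"] x
      by (intro integral_eq_nn_integral) (auto simp: r_nonneg)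
    finally show ?thesis .
  qed
  have R_nonneg: "R x \<ge> 0" if "x \<in> space (node_space k)" for x using R[OF that] h_nonneg by simp
  have G_meas: "G \<in> borel_measurable (node_space k)"
    using G_cont by (rule borel_measurable_continuous_on_PiE)
  obtain B where B: "\<forall>x\<in>PiE {1..k} (\<lambda>_. UNIV). (\<exists>i\<in>{1..k}. \<bar>x i\<bar> > B) \<longrightarrow> G x = 0" using G_supp ..
  obtain D where D: "D \<ge> 0" "\<And>x. x \<in> PiE {1..k} (\<lambda>_. UNIV) \<Longrightarrow> \<bar>G x\<bar> \<le> D"
    using bounded_continuous_compact_support[OF G_cont B] by blast
  have degP: "degree (P \<omega>) \<le> n" for \<omega>
    unfolding P_def by (intro degree_sum_le) (auto intro: order.trans[OF degree_smult_le] simp: deg)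
  \<comment> \<open>Monomial coefficients of the polynomial with orthonormal coefficients
    \<open>u\<close>; the measurability results for \<open>vec_poly\<close> thereby apply to the
    random polynomial.\<close>
  define Q where "Q u = coeff_vec n (\<Sum>i\<le>n. smult (u i) (p i))" for u
  have Q_meas[measurable]: "Q \<in> lborel_vec n \<rightarrow>\<^sub>M lborel_vec n"
    unfolding Q_def[abs_def] coeff_vec_def
  proof (rule measurable_restrict)
    fix j
    have "(\<lambda>u. \<Sum>i\<le>n. u i * coeff (p i) j) \<in> borel_measurable (lborel_vec n)"
      by (intro borel_measurable_sum borel_measurable_times borel_measurable_const
        measurable_lborel_vec_component[OF measurable_ident_sets[OF refl]]) simp
    then show "(\<lambda>u. coeff (\<Sum>i\<le>n. smult (u i) (p i)) j) \<in> lborel_vec n \<rightarrow>\<^sub>M lborel"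
      by (simp add: coeff_sum)
  qed
  have vecQ: "vec_poly n (Q u) = (\<Sum>i\<le>n. smult (u i) (p i))" for u
    unfolding Q_def
    by (intro vec_poly_coeff_vec degree_sum_le) (auto intro: order.trans[OF degree_smult_le] simp: deg)
  have vecP: "vec_poly n (Q (\<lambda>i\<in>{..n}. \<xi> i \<omega>)) = P \<omega>" for \<omega>
    unfolding vecQ P_def by (rule sum.cong) auto
  have sum_meas: "(\<lambda>\<omega>. \<Sum>x\<in>root_tuples k (P \<omega>). g x) \<in> borel_measurable M"
    if "g \<in> borel_measurable (node_space k)" for g :: "(nat \<Rightarrow> real) \<Rightarrow> ennreal"
  proof -
    have "(\<lambda>\<omega>. \<lambda>i\<in>{..n}. \<xi> i \<omega>) \<in> M \<rightarrow>\<^sub>M lborel_vec n"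
      by (rule measurable_restrict) simp
    from borel_measurable_sum_root_tuples[OF measurable_compose[OF this Q_meas], of "\<lambda>_. g" k] that
    show ?thesis unfolding vecP by simp
  qed
  have formula: "(\<integral>\<^sup>+\<omega>. (\<Sum>x\<in>root_tuples k (P \<omega>). g x) \<partial>M) = (\<integral>\<^sup>+x. g x * (ennreal (h x) * rr x) \<partial>node_space k)"
    if g: "g \<in> borel_measurable (node_space k)" for g :: "(nat \<Rightarrow> real) \<Rightarrow> ennreal"
  proof -
    define \<Phi> where "\<Phi> u = (\<Sum>x\<in>root_tuples k (vec_poly n (Q u)). g x)" for u
    have \<Phi>_meas[measurable]: "\<Phi> \<in> borel_measurable (lborel_vec n)"
      unfolding \<Phi>_def[abs_def] by (rule borel_measurable_sum_root_tuples[OF Q_meas]) (use g in simp)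
    define F where "F u = (\<Prod>l\<le>n. ennreal (f l (u l)))" for u :: "nat \<Rightarrow> real"
    have F_meas[measurable]: "F \<in> borel_measurable (lborel_vec n)"
      unfolding F_def[abs_def]
      by (intro borel_measurable_prod_ennreal measurable_compose[OF _ measurable_ennreal]
        measurable_compose[OF measurable_lborel_vec_component[OF measurable_ident_sets[OF refl]] f_meas]) auto
    have C_diag: "C l l = inverse (lead_coeff (p l))" for l
      unfolding C_def by (rule moment_orthonormal_diag[OF moments deg lead_pos orthonormal])
    have C_pos: "C l l > 0" for l using lead_pos[of l] by (simp add: C_diag)
    have vecT: "vec_poly n (Q (triangular_map C n a)) = vec_poly n a" for a
      unfolding vecQ C_def by (rule sum_triangular_map_orthonormal[OF moments deg lead_pos orthonormal])
    let ?c = "ennreal (\<Prod>m\<le>n. inverse (lead_coeff (p m)))"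
    define H where "H a x = F (triangular_map C n a) * g x" for a x
    have H_meas: "(\<lambda>(a, x). H a x) \<in> borel_measurable (lborel_vec (k + m) \<Otimes>\<^sub>M node_space k)"
    proof -
      note [measurable] = g
      show ?thesis unfolding H_def case_prod_beta n[symmetric] by measurable
    qed
    have diag: "(\<Prod>l\<le>n. \<bar>C l l\<bar>) = (\<Prod>m\<le>n. inverse (lead_coeff (p m)))"
      by (rule prod.cong[OF refl]) (metis C_pos C_diag abs_of_pos)
    let ?I = "\<lambda>x. \<integral>\<^sup>+t. H (coeff_vec (k + m) (node_poly k x * vec_poly m t)) x
        * ennreal (root_weight k x (vec_poly m t)) \<partial>lborel_vec m"
    \<comment> \<open>In the coordinates \<open>a\<close> the random polynomial is
      \<open>vec_poly n a\<close>, so only the density factor still carries the change of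
      basis.\<close>
    have "F (triangular_map C n a) * \<Phi> (triangular_map C n a) = (\<Sum>x\<in>root_tuples k (vec_poly (k + m) a). H a x)" for a
    proof -
      have "\<Phi> (triangular_map C n a) = (\<Sum>x\<in>root_tuples k (vec_poly (k + m) a). g x)"
        by (simp only: \<Phi>_def vecT n[symmetric])
      then show ?thesis by (simp only: H_def sum_distrib_left)
    qed
    then have factor: "(\<integral>\<^sup>+a. F (triangular_map C n a) * \<Phi> (triangular_map C n a) \<partial>lborel_vec n) =
        (\<integral>\<^sup>+x. ?I x \<partial>node_space k)"
      using nn_integral_sum_root_tuples[OF H_meas] unfolding n[symmetric] by simp
    have "(\<integral>\<^sup>+\<omega>. (\<Sum>x\<in>root_tuples k (P \<omega>). g x) \<partial>M) = (\<integral>\<^sup>+\<omega>. \<Phi> (\<lambda>i\<in>{..n}. \<xi> i \<omega>) \<partial>M)"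
      by (simp add: \<Phi>_def vecP)
    also have "\<dots> = (\<integral>\<^sup>+u. F u * \<Phi> u \<partial>lborel_vec n)"
      unfolding F_def using indep dens \<Phi>_meas
      by (intro nn_integral_indep_densities M_prob) (auto simp: atLeast0AtMost)
    also have "\<dots> = ennreal (\<Prod>l\<le>n. \<bar>C l l\<bar>) * (\<integral>\<^sup>+a. F (triangular_map C n a) * \<Phi> (triangular_map C n a) \<partial>lborel_vec n)"
      using C_pos by (intro nn_integral_triangular_map) (auto simp: less_imp_neq[symmetric])
    also have "\<dots> = ?c * (\<integral>\<^sup>+x. ?I x \<partial>node_space k)"
      by (simp only: diag factor)
    also have "\<dots> = (\<integral>\<^sup>+x. ?c * ?I x \<partial>node_space k)"
    proof (rule nn_integral_cmult[symmetric])
      have "(\<lambda>(x, t). H (coeff_vec (k + m) (node_poly k x * vec_poly m t)) x * ennreal (root_weight k x (vec_poly m t)))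
          \<in> borel_measurable (node_space k \<Otimes>\<^sub>M lborel_vec m)"
        unfolding case_prod_beta H_def n[symmetric]
        by (intro borel_measurable_times_ennreal measurable_compose[OF _ F_meas] measurable_compose[OF measurable_fst g]
          measurable_compose[OF measurable_coeff_vec_node_poly measurable_triangular_map]
          measurable_compose[OF borel_measurable_root_weight measurable_ennreal] measurable_fst measurable_snd)
      from V.borel_measurable_nn_integral[OF this]
      show "?I \<in> borel_measurable (node_space k)" .
    qed
    also have "\<dots> = (\<integral>\<^sup>+x. g x * (ennreal (h x) * rr x) \<partial>node_space k)"
    proof (rule nn_integral_cong)
      fix x assume x: "x \<in> space (node_space k)"
      let ?v = "\<Prod>i\<in>{1..k}. \<Prod>j\<in>{i<..k}. \<bar>x i - x j\<bar>"
      have v: "?v \<ge> 0" by (intro prod_nonneg) auto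
      have "H (coeff_vec (k + m) (node_poly k x * vec_poly m t)) x * ennreal (root_weight k x (vec_poly m t))
          = g x * ennreal ?v * ennreal (r x t)" for t
      proof -
        let ?f = "\<Prod>l\<le>n. f l (T x t l)" and ?q = "\<Prod>i\<in>{1..k}. \<bar>poly (vec_poly m t) (x i)\<bar>"
        have "F (T x t) = ennreal ?f"
          unfolding F_def by (intro prod_ennreal) (simp add: dens_nonneg)
        then have H: "H (coeff_vec (k + m) (node_poly k x * vec_poly m t)) x = ennreal ?f * g x"
          by (simp only: H_def T_def n[symmetric])
        have W: "ennreal (root_weight k x (vec_poly m t)) = ennreal ?v * ennreal ?q"
          unfolding root_weight_def by (rule ennreal_mult[OF v]) (simp add: prod_nonneg)
        have r: "ennreal (r x t) = ennreal ?f * ennreal ?q"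
          unfolding r_def by (rule ennreal_mult) (intro prod_nonneg; simp add: dens_nonneg)+
        show ?thesis unfolding H W r by (simp only: mult_ac)
      qed
      then have "?I x = (\<integral>\<^sup>+t. g x * ennreal ?v * ennreal (r x t) \<partial>lborel_vec m)"
        by (simp only:)
      also have "\<dots> = g x * ennreal ?v * rr x"
        unfolding rr_def using x
        by (intro nn_integral_cmult measurable_compose[OF r_meas measurable_ennreal]) auto
      finally show "?c * ?I x = g x * (ennreal (h x) * rr x)"
        unfolding h_def ennreal_mult[OF inv_nonneg v] by (simp only: mult_ac)
    qed
    finally show ?thesis .
  qed
  \<comment> \<open>\<open>D\<close> bounds the modulus of \<open>G\<close>, and a polynomial of
    degree at most \<open>n\<close> has at most \<open>n ^ k\<close> root tuples.\<close>
  define b where "b = D * real (n ^ k)"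
  have sum_bound: "(\<Sum>x\<in>root_tuples k (P \<omega>). ennreal (s * G x)) \<le> ennreal b" if "\<bar>s\<bar> = 1" for s \<omega>
  proof -
    have "s * G x \<le> D" if "x \<in> root_tuples k (P \<omega>)" for x
    proof -
      have "\<bar>s * G x\<bar> \<le> D" using D(2)[of x] that \<open>\<bar>s\<bar> = 1\<close> by (auto simp: root_tuples_def abs_mult)
      then show ?thesis by simp
    qed
    then have "(\<Sum>x\<in>root_tuples k (P \<omega>). ennreal (s * G x)) \<le> of_nat (card (root_tuples k (P \<omega>))) * ennreal D"
      by (intro sum_bounded_above ennreal_leI)
    also have "\<dots> = ennreal (real (card (root_tuples k (P \<omega>))) * D)"
      using D(1) by (simp add: ennreal_of_nat_eq_real_of_nat ennreal_mult)
    also have "card (root_tuples k (P \<omega>)) \<le> n ^ k"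
      using card_root_tuples_le[of k "P \<omega>"] power_mono[OF degP[of \<omega>], of k] by simp
    then have "ennreal (real (card (root_tuples k (P \<omega>))) * D) \<le> ennreal b"
      unfolding b_def mult.commute[of D] using D(1) by (intro ennreal_leI mult_right_mono) simp_all
    finally show ?thesis .
  qed
  \<comment> \<open>As \<open>ennreal\<close> truncates negative numbers to 0, the choices 1 and -1
    of \<open>s\<close> select the positive and the negative part of \<open>G\<close>.\<close>
  define S where "S s \<omega> = (\<Sum>x\<in>root_tuples k (P \<omega>). ennreal (s * G x))" for s \<omega>
  have S_meas[measurable]: "S s \<in> borel_measurable M" for s
    unfolding S_def[abs_def] by (rule sum_meas) (use G_meas in measurable)
  have S_fin: "S s \<omega> < \<infinity>" if "\<bar>s\<bar> = 1" for s \<omega>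
    using sum_bound[OF that, of \<omega>] unfolding S_def by (rule le_less_trans) simp
  have ES_fin: "(\<integral>\<^sup>+\<omega>. S s \<omega> \<partial>M) < \<infinity>" if "\<bar>s\<bar> = 1" for s
  proof -
    have "(\<integral>\<^sup>+\<omega>. S s \<omega> \<partial>M) \<le> (\<integral>\<^sup>+\<omega>. ennreal b \<partial>M)"
      using sum_bound[OF that] unfolding S_def by (intro nn_integral_mono)
    also have "\<dots> < \<infinity>" by (simp add: emeasure_space_1)
    finally show ?thesis .
  qed
  have int_GR: "(\<integral>\<^sup>+x. ennreal (s * (G x * R x)) \<partial>node_space k) = (\<integral>\<^sup>+\<omega>. S s \<omega> \<partial>M)" if s: "\<bar>s\<bar> = 1" for s
  proof -
    have sG: "(\<lambda>x. ennreal (s * G x)) \<in> borel_measurable (node_space k)" using G_meas by measurable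
    have eq: "(\<integral>\<^sup>+\<omega>. S s \<omega> \<partial>M) = (\<integral>\<^sup>+x. ennreal (s * G x) * (ennreal (h x) * rr x) \<partial>node_space k)"
      unfolding S_def by (rule formula[OF sG])
    \<comment> \<open>A finite integral makes the product finite almost everywhere. Where
      \<open>rr x\<close> is infinite, one of the other factors must then be 0, so replacing
      \<infinity> by the default 0 changes nothing.\<close>
    have "AE x in node_space k. ennreal (s * G x) * (ennreal (h x) * rr x) \<noteq> \<infinity>"
    proof (rule nn_integral_PInf_AE)
      show "(\<lambda>x. ennreal (s * G x) * (ennreal (h x) * rr x)) \<in> borel_measurable (node_space k)"
        using sG rr_meas h_meas by measurable
      show "(\<integral>\<^sup>+x. ennreal (s * G x) * (ennreal (h x) * rr x) \<partial>node_space k) \<noteq> \<infinity>"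
        using ES_fin[OF s] unfolding eq by simp
    qed
    then have "AE x in node_space k. ennreal (s * (G x * R x)) = ennreal (s * G x) * (ennreal (h x) * rr x)"
      using AE_space
    proof eventually_elim
      case (elim x)
      have eqR: "ennreal (s * (G x * R x)) = ennreal (s * G x) * (ennreal (h x) * ennreal (enn2real (rr x)))"
        using h_nonneg[of x] by (simp add: R[OF elim(2)] ennreal_mult''[symmetric] mult_ac)
      show ?case
      proof (cases "rr x = \<infinity>")
        case True
        then have "ennreal (s * G x) = 0 \<or> ennreal (h x) = 0"
          using elim(1) by (auto simp: ennreal_mult_eq_top_iff)
        then show ?thesis unfolding eqR by auto
      next
        case False
        then show ?thesis unfolding eqR by (simp add: less_top)
      qed
    qed
    then show ?thesis unfolding eq by (rule nn_integral_cong_AE)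
  qed
  have GR_meas: "(\<lambda>x. G x * R x) \<in> borel_measurable (node_space k)"
  proof -
    have "(\<lambda>x. G x * (h x * enn2real (rr x))) \<in> borel_measurable (node_space k)"
      using G_meas h_meas rr_meas by measurable
    then show ?thesis by (subst measurable_cong[where g="\<lambda>x. G x * (h x * enn2real (rr x))"]) (simp_all add: R)
  qed
  have integrable: "integrable (node_space k) (\<lambda>x. G x * R x)"
    unfolding real_integrable_def
    using GR_meas int_GR[of 1] int_GR[of "-1"] ES_fin[of 1] ES_fin[of "-1"] by (simp add: less_top)
  \<comment> \<open>Pointwise, \<open>a = max 0 a - max 0 (- a)\<close>; the sums are finite, so
    \<open>enn2real\<close> loses nothing.\<close>
  have Z: "(\<Sum>x\<in>root_tuples k (P \<omega>). G x) = enn2real (S 1 \<omega>) - enn2real (S (-1) \<omega>)" for \<omega>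
  proof -
    have "enn2real (S s \<omega>) = (\<Sum>x\<in>root_tuples k (P \<omega>). max 0 (s * G x))" for s
    proof -
      have "S s \<omega> = (\<Sum>x\<in>root_tuples k (P \<omega>). ennreal (max 0 (s * G x)))"
        unfolding S_def by (simp add: ennreal_max_0)
      also have "\<dots> = ennreal (\<Sum>x\<in>root_tuples k (P \<omega>). max 0 (s * G x))"
        by (rule sum_ennreal) simp
      finally show ?thesis by (simp add: sum_nonneg)
    qed
    then show ?thesis by (auto simp: sum_subtractf[symmetric] intro!: sum.cong)
  qed
  have int_S: "integrable M (\<lambda>\<omega>. enn2real (S s \<omega>))" "(\<integral>\<omega>. enn2real (S s \<omega>) \<partial>M) = enn2real (\<integral>\<^sup>+\<omega>. S s \<omega> \<partial>M)"
    if s: "\<bar>s\<bar> = 1" for s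
  proof -
    have eq: "(\<integral>\<^sup>+\<omega>. ennreal (enn2real (S s \<omega>)) \<partial>M) = (\<integral>\<^sup>+\<omega>. S s \<omega> \<partial>M)"
      using S_fin[OF s] by (intro nn_integral_cong) simp
    show "integrable M (\<lambda>\<omega>. enn2real (S s \<omega>))"
      using ES_fin[OF s] by (intro integrableI_nonneg) (auto simp: eq)
    show "(\<integral>\<omega>. enn2real (S s \<omega>) \<partial>M) = enn2real (\<integral>\<^sup>+\<omega>. S s \<omega> \<partial>M)"
      by (subst integral_eq_nn_integral) (auto simp: eq)
  qed
  have "(\<integral>\<omega>. (\<Sum>x\<in>zero_tuples k (\<lambda>y. \<Sum>i\<le>n. \<xi> i \<omega> * poly (p i) y). G x) \<partial>M) =
      (\<integral>\<omega>. (\<Sum>x\<in>root_tuples k (P \<omega>). G x) \<partial>M)"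
  proof -
    have "(\<lambda>y. \<Sum>i\<le>n. \<xi> i \<omega> * poly (p i) y) = poly (P \<omega>)" for \<omega>
      by (auto simp: P_def poly_sum)
    then show ?thesis by (simp add: sum_zero_tuples_poly[OF k_ge])
  qed
  also have "\<dots> = enn2real (\<integral>\<^sup>+\<omega>. S 1 \<omega> \<partial>M) - enn2real (\<integral>\<^sup>+\<omega>. S (-1) \<omega> \<partial>M)"
    unfolding Z using int_S[of 1] int_S[of "-1"] by simp
  also have "\<dots> = (\<integral>x. G x * R x \<partial>node_space k)"
    unfolding real_lebesgue_integral_def[OF integrable] using int_GR[of 1] int_GR[of "-1"] by simp
  finally show ?thesis by (rule conjI[OF integrable])
qed

end
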